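(* There is an absolute constant $\varepsilon_0>0$ such that the following is true. Let $G$ be an abelian group, let $X, Y$ be $G$-valued random variables, and suppose that $d_{\mathrm{ent}}(X,Y) \leq \varepsilon_0$. Then there is some finite subgroup $H$ of $G$ such that $$d_{\mathrm{ent}}(X, U_H) \leq 12\, d_{\mathrm{ent}}(X,Y) \quad\text{and}\quad d_{\mathrm{ent}}(Y, U_H) \leq 12\, d_{\mathrm{ent}}(X,Y).$$
   Context: A $G$-valued random variable is a random variable taking values in a finite subset of the (additively written) abelian group $G$. Its Shannon entropy is $\mathbf{H}(X) = \sum_x p_X(x)\log\frac{1}{p_X(x)}$, where $p_X(x)=\mathbf{P}(X=x)$, $\log$ is the natural logarithm, and terms with $p_X(x)=0$ are $0$. For $G$-valued random variables $X,Y$ (not necessarily independent or defined on the same sample space), the entropic Ruzsa distance is $$d_{\mathrm{ent}}(X,Y) = \mathbf{H}(X'-Y') - \tfrac12 \mathbf{H}(X') - \tfrac12\mathbf{H}(Y'),$$ where $X',Y'$ are independent copies of $X,Y$ respectively. $U_H$ denotes a random variable uniformly distributed on $H$. "Absolute constant" means in particular that $\varepsilon_0$ does not depend on $G$, $X$, $Y$. *)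

theory Defs
  imports "HOL-Probability.Probability" "HOL-Algebra.Group"
begin

text \<open>
  Entropies depend only on distributions, so a random variable is represented by its law, a
  probability mass function. Groups are in HOL-Algebra's multiplicative notation:
  the difference \<open>x - y\<close> is \<open>x \<otimes> inv y\<close>.
\<close>

definition group_valued :: "'a monoid \<Rightarrow> 'a pmf \<Rightarrow> bool" where
  "group_valued G X \<longleftrightarrow> finite (set_pmf X) \<and> set_pmf X \<subseteq> carrier G"

definition shannon_entropy :: "'a pmf \<Rightarrow> real" where
  "shannon_entropy X = (\<Sum>x\<in>set_pmf X. pmf X x * ln (1 / pmf X x))"

text \<open>\<^term>\<open>pair_pmf X Y\<close> is the joint law of independent copies of \<open>X\<close> and \<open>Y\<close>.\<close>

definition diff_pmf :: "'a monoid \<Rightarrow> 'a pmf \<Rightarrow> 'a pmf \<Rightarrow> 'a pmf" where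
  "diff_pmf G X Y = map_pmf (\<lambda>(x, y). x \<otimes>\<^bsub>G\<^esub> inv\<^bsub>G\<^esub> y) (pair_pmf X Y)"

definition ruzsa_dist :: "'a monoid \<Rightarrow> 'a pmf \<Rightarrow> 'a pmf \<Rightarrow> real" where
  "ruzsa_dist G X Y =
     shannon_entropy (diff_pmf G X Y) - 1/2 * shannon_entropy X - 1/2 * shannon_entropy Y"

text \<open>
  The constant \<open>\<epsilon>\<close> is admissible for all abelian groups whose elements are drawn from
  the type \<^typ>\<open>'a\<close>. The type is an explicit argument because an absolute constant has to be
  chosen before the type, whereas HOL cannot quantify over types under an existential quantifier:
  in \<open>\<exists>\<epsilon>>0. admissible_const TYPE('a) \<epsilon>\<close> the witness might depend on \<^typ>\<open>'a\<close>.
  An \<open>\<epsilon>\<close> that is obtained for \<^typ>\<open>nat\<close> and is then shown to be admissible for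
  arbitrary \<^typ>\<open>'a\<close> is independent of the type as well. (Nothing is lost: finitely many group
  elements generate a countable subgroup, which has an isomorphic copy inside \<^typ>\<open>nat\<close>.)
\<close>

definition admissible_const :: "'a itself \<Rightarrow> real \<Rightarrow> bool" where
  "admissible_const (_ :: 'a itself) \<epsilon> \<longleftrightarrow>
     (\<forall>(G :: 'a monoid) X Y.
        comm_group G \<longrightarrow> group_valued G X \<longrightarrow> group_valued G Y \<longrightarrow> ruzsa_dist G X Y \<le> \<epsilon> \<longrightarrow>
        (\<exists>H. subgroup H G \<and> finite H \<and>
             ruzsa_dist G X (pmf_of_set H) \<le> 12 * ruzsa_dist G X Y \<and>
             ruzsa_dist G Y (pmf_of_set H) \<le> 12 * ruzsa_dist G X Y))"

end

theory Submission
  imports Defs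
begin

text \<open>
  Write \<open>\<epsilon>\<close> for the distance of \<open>X\<close> and \<open>Y\<close>. The mutual information of \<open>X - Y\<close> and \<open>Y\<close> is at most \<open>2\<epsilon>\<close>,
  so by Pinsker \<open>X - y\<close> and \<open>X - y'\<close> are close in total variation for typical values \<open>y, y'\<close> of \<open>Y\<close>,
  and likewise with the roles exchanged. The shifts that nearly preserve \<open>X\<close> therefore form a
  finite subgroup \<open>H\<close>, and \<open>X\<close> and \<open>Y\<close> are each concentrated on one coset of \<open>H\<close>.

  To get a bound linear in \<open>\<epsilon>\<close>, let \<open>X' = X - U\<^sub>H\<close>, \<open>\<alpha>(X) = H(X') - ln |H|\<close> (the entropy of \<open>X\<close> modulo \<open>H\<close>)
  and \<open>D(X) = H(X') - H(X)\<close>, the divergence of \<open>X\<close> from \<open>X'\<close>. Then the distance of \<open>X\<close> and \<open>U\<^sub>H\<close> is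
  \<open>\<alpha>(X)/2 + D(X)/2\<close>, while \<open>\<epsilon> = \<alpha>(X - Y) - \<alpha>(X)/2 - \<alpha>(Y)/2 + D(X)/2 + D(Y)/2 - D(X - Y)\<close>.
  Convolving with the nearly \<open>H\<close>-invariant \<open>Y\<close> contracts the divergence, so \<open>D(X - Y) \<le> D(X)/4\<close>; concentration
  modulo \<open>H\<close> makes \<open>\<alpha>\<close> nearly additive, so \<open>\<alpha>(X - Y) \<ge> 3/5 (\<alpha>(X) + \<alpha>(Y))\<close>. Both follow with room to spare.

  For an arbitrary type, the supports lie in a countable subgroup, which is copied into the naturals.
\<close>

subsection \<open>Two real functions\<close>

text \<open>The convex generator of the divergence: \<open>kl_div P Q\<close> is the
  \<open>Q\<close>-mean of \<open>psi (P/Q - 1)\<close>. Subtracting \<open>t\<close> leaves the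
  mean unchanged but makes every term nonnegative and of second order at \<open>0\<close>.\<close>

definition psi :: "real \<Rightarrow> real" where
  "psi t = (1 + t) * ln (1 + t) - t"

lemma psi_0 [simp]: "psi 0 = 0" by (simp add: psi_def)

lemma psi_deriv: "t > -1 \<Longrightarrow> (psi has_real_derivative ln (1 + t)) (at t)"
  unfolding psi_def[abs_def] by (auto intro!: derivative_eq_intros)

lemma psi_deriv_chain:
  assumes "(g has_real_derivative D) (at x)" "g x > -1"
  shows "((\<lambda>x. psi (g x)) has_real_derivative ln (1 + g x) * D) (at x)"
  by (rule DERIV_chain2[where f = psi, OF psi_deriv[OF assms(2)] assms(1)])

lemma psi_mono:
  assumes "0 \<le> s" "s \<le> t" shows "psi s \<le> psi t"
  by (rule DERIV_nonneg_imp_nondecreasing[OF assms(2)])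
    (use assms in \<open>auto intro!: exI[of _ "ln (1 + _)"] psi_deriv\<close>)

lemma psi_convex: "convex_on {0..} psi"
proof (rule f''_ge0_imp_convex[where f' = "\<lambda>t. ln (1 + t)" and f'' = "\<lambda>t. 1 / (1 + t)"])
  show "convex {0::real..}" by simp
  show "(psi has_real_derivative ln (1 + x)) (at x)" if "x \<in> {0..}" for x
    using that by (intro psi_deriv) auto
  show "((\<lambda>t. ln (1 + t)) has_real_derivative 1 / (1 + x)) (at x)" if "x \<in> {0..}" for x :: real
    using that by (auto intro!: derivative_eq_intros)
qed auto

lemma psi_nonneg: "0 \<le> t \<Longrightarrow> 0 \<le> psi t"
  using psi_mono[of 0 t] by simp

lemma le_of_deriv_le:
  fixes f g :: "real \<Rightarrow> real"
  assumes "f 0 \<le> g 0" "0 \<le> t"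
    and "\<And>x. 0 \<le> x \<Longrightarrow> x \<le> t \<Longrightarrow> (f has_real_derivative f' x) (at x)"
    and "\<And>x. 0 \<le> x \<Longrightarrow> x \<le> t \<Longrightarrow> (g has_real_derivative g' x) (at x)"
    and "\<And>x. 0 \<le> x \<Longrightarrow> x \<le> t \<Longrightarrow> f' x \<le> g' x"
  shows "f t \<le> g t"
proof -
  have "(\<lambda>x. g x - f x) 0 \<le> (\<lambda>x. g x - f x) t"
  proof (rule DERIV_nonneg_imp_nondecreasing[OF assms(2)])
    fix x assume x: "0 \<le> x" "x \<le> t"
    show "\<exists>y. ((\<lambda>x. g x - f x) has_real_derivative y) (at x) \<and> y \<ge> 0"
      using assms(3-5)[OF x] by (intro exI[of _ "g' x - f' x"]) (auto intro: derivative_intros)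
  qed
  then show ?thesis using assms(1) by simp
qed

text \<open>After differentiation this is \<open>1 + 2 * x \<le> (1 + x)^2\<close>. It serves to
  remove a factor \<open>2\<close> from the argument of \<open>psi\<close> once Jensen has been
  applied.\<close>

lemma psi_double: assumes "0 \<le> t" shows "psi (2 * t) \<le> 4 * psi t"
proof (rule le_of_deriv_le[where f = "\<lambda>x. psi (2 * x)" and g = "\<lambda>x. 4 * psi x" and
    f' = "\<lambda>x. 2 * ln (1 + 2 * x)" and g' = "\<lambda>x. 4 * ln (1 + x)"])
  fix x :: real assume x: "0 \<le> x"
  show "((\<lambda>x. psi (2 * x)) has_real_derivative 2 * ln (1 + 2 * x)) (at x)"
  proof -
    have "((\<lambda>x. 2 * x) has_real_derivative 2) (at x)" by (auto intro!: derivative_eq_intros)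
    from psi_deriv_chain[OF this] show ?thesis using x by (simp add: mult.commute)
  qed
  show "((\<lambda>x. 4 * psi x) has_real_derivative 4 * ln (1 + x)) (at x)"
    using x by (intro DERIV_cmult psi_deriv) auto
  have "ln (1 + 2 * x) \<le> ln ((1 + x)\<^sup>2)"
    using x by (intro ln_mono) (auto simp: power2_eq_square algebra_simps)
  also have "\<dots> = 2 * ln (1 + x)" using x by (simp add: ln_realpow)
  finally show "2 * ln (1 + 2 * x) \<le> 4 * ln (1 + x)" by simp
qed (use assms in auto)

lemma psi_le_square: assumes "0 \<le> t" shows "psi t \<le> t\<^sup>2"
proof -
  have "ln (1 + t) \<le> t" using assms ln_add_one_self_le_self by simp
  then have "(1 + t) * ln (1 + t) \<le> (1 + t) * t" using assms by (intro mult_left_mono) auto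
  then show ?thesis by (simp add: psi_def power2_eq_square algebra_simps)
qed

lemma psi_ge_square: assumes "0 \<le> t" "t \<le> 1" shows "t\<^sup>2 / 4 \<le> psi t"
proof (rule le_of_deriv_le[where f = "\<lambda>x. x\<^sup>2 / 4" and g = psi and f' = "\<lambda>x. x / 2" and g' = "\<lambda>x. ln (1 + x)"])
  fix x assume x: "0 \<le> x" "x \<le> t"
  show "((\<lambda>x. x\<^sup>2 / 4) has_real_derivative x / 2) (at x)"
    by (auto intro!: derivative_eq_intros)
  show "(psi has_real_derivative ln (1 + x)) (at x)" using x by (intro psi_deriv) auto
  have "ln (1 / (1 + x)) \<le> 1 / (1 + x) - 1" using x by (intro ln_le_minus_one) auto
  then have "ln (1 + x) \<ge> x / (1 + x)" using x by (simp add: ln_div field_simps)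
  moreover have "x / 2 \<le> x / (1 + x)" using x assms by (intro divide_left_mono) auto
  ultimately show "x / 2 \<le> ln (1 + x)" by linarith
qed (use assms in auto)

text \<open>The junk value \<open>ln 0 = 0\<close> makes \<open>psi (-1) = 1\<close>, the continuous extension.\<close>

lemma psi_neg_le_square: assumes "0 \<le> t" "t \<le> 1" shows "psi (-t) \<le> t\<^sup>2"
proof (cases "t = 1")
  case False
  then have "ln (1 - t) \<le> - t" using assms ln_le_minus_one[of "1 - t"] by simp
  then have "(1 - t) * ln (1 - t) \<le> (1 - t) * (- t)" using assms by (intro mult_left_mono) auto
  then show ?thesis by (simp add: psi_def power2_eq_square algebra_simps)
qed (simp add: psi_def)

lemma psi_neg_ge_square: assumes "0 \<le> t" "t \<le> 1" shows "t\<^sup>2 / 2 \<le> psi (-t)"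
proof (cases "t = 1")
  case False
  show ?thesis
  proof (rule le_of_deriv_le[where f = "\<lambda>x. x\<^sup>2 / 2" and g = "\<lambda>x. psi (- x)" and f' = "\<lambda>x. x" and g' = "\<lambda>x. - ln (1 - x)"])
    fix x assume x: "0 \<le> x" "x \<le> t"
    show "((\<lambda>x. x\<^sup>2 / 2) has_real_derivative x) (at x)"
      by (auto intro!: derivative_eq_intros)
    show "((\<lambda>x. psi (- x)) has_real_derivative - ln (1 - x)) (at x)"
    proof -
      have "(uminus has_real_derivative -1) (at x)" by (auto intro!: derivative_eq_intros)
      from psi_deriv_chain[OF this] show ?thesis using x False assms by simp
    qed
    show "x \<le> - ln (1 - x)" using x False assms ln_le_minus_one[of "1 - x"] by simp
  qed (use assms in auto)
qed (simp add: psi_def)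

text \<open>For negative \<open>t\<close> both sides are comparable with a square:
  \<open>psi t \<le> t^2 \<le> 4 * psi \<bar>t\<bar>\<close>. The reverse comparison below goes
  through \<open>t^2\<close> as well.\<close>

lemma psi_le_psi_abs: assumes "-1 \<le> t" shows "psi t \<le> 4 * psi \<bar>t\<bar>"
proof (cases "t \<ge> 0")
  case True then show ?thesis using psi_nonneg[of t] by simp
next
  case False
  then show ?thesis using psi_neg_le_square[of "-t"] psi_ge_square[of "-t"] assms by simp
qed

lemma psi_abs_le_psi: assumes "-1 \<le> t" shows "psi \<bar>t\<bar> \<le> 2 * psi t"
proof (cases "t \<ge> 0")
  case True then show ?thesis using psi_nonneg[of t] by simp
next
  case False
  then show ?thesis using psi_neg_ge_square[of "-t"] psi_le_square[of "-t"] assms by simp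
qed

text \<open>Jensen for weights of total mass at most \<open>1\<close>: the missing mass is placed on
  an extra point \<open>None\<close> with argument \<open>0\<close>, where \<open>psi\<close>
  vanishes.\<close>

lemma psi_weighted_sum:
  assumes "finite T" "\<And>y. y \<in> T \<Longrightarrow> 0 \<le> w y" "(\<Sum>y\<in>T. w y) \<le> 1" "\<And>y. y \<in> T \<Longrightarrow> 0 \<le> t y"
  shows "psi (\<Sum>y\<in>T. w y * t y) \<le> (\<Sum>y\<in>T. w y * psi (t y))"
proof -
  let ?w = "\<lambda>y. case y of None \<Rightarrow> 1 - (\<Sum>y\<in>T. w y) | Some y \<Rightarrow> w y"
  let ?t = "\<lambda>y. case y of None \<Rightarrow> 0 | Some y \<Rightarrow> t y"
  let ?T = "insert None (Some ` T)"
  have s: "(\<Sum>y\<in>?T. g y) = g None + (\<Sum>y\<in>T. g (Some y))" for g :: "_ \<Rightarrow> real"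
    using assms(1) by (subst sum.insert) (auto simp: sum.reindex)
  have "psi (\<Sum>y\<in>?T. ?w y *\<^sub>R ?t y) \<le> (\<Sum>y\<in>?T. ?w y * psi (?t y))"
  proof (rule convex_on_sum[OF _ _ psi_convex])
    show "(\<Sum>y\<in>?T. ?w y) = 1" unfolding s by simp
  qed (use assms in auto)
  then show ?thesis unfolding s by simp
qed

section \<open>The entropy summand\<close>

definition ent :: "real \<Rightarrow> real" where
  "ent u = u * ln (1 / u)"

text \<open>The maximum of \<open>ent\<close> is at \<open>1/e\<close>, whence the bound on
  \<open>u\<close>. The difference \<open>ent u - ent s\<close> equals
  \<open>(u - s) * (- ln u) - s * ln (u/s)\<close>; here \<open>- ln u \<ge> 1\<close> and
  \<open>s * ln (u/s) \<le> u - s\<close>.\<close>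

lemma ent_mono:
  assumes "0 \<le> s" "s \<le> u" "u \<le> exp (-1)"
  shows "ent s \<le> ent u"
proof (cases "s = 0")
  case True
  have "u \<le> 1" using assms(3) by (meson exp_le_one_iff neg_le_0_iff_le order_trans zero_le_one)
  then show ?thesis using True assms by (cases "u = 0") (auto simp: ent_def)
next
  case False
  then have p: "s > 0" "u > 0" using assms by auto
  have "ln u \<le> ln (exp (-1))" using p assms(3) by (subst ln_le_cancel_iff) auto
  then have "ln u \<le> -1" by simp
  have "ln (u / s) \<le> u / s - 1" using p by (intro ln_le_minus_one) auto
  then have "s * ln (u / s) \<le> s * (u / s - 1)" using p by (intro mult_left_mono) auto
  also have "\<dots> = u - s" using p by (simp add: field_simps)
  also have "\<dots> \<le> (u - s) * (- ln u)" using \<open>ln u \<le> -1\<close> assms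
    mult_left_mono[of 1 "- ln u" "u - s"] by simp
  finally show ?thesis using p by (simp add: ent_def ln_div algebra_simps)
qed

text \<open>The loss \<open>ent s + ent t - ent (s + t)\<close> is \<open>s + t\<close> times the
  entropy of a two-point law with weights proportional to \<open>s\<close> and \<open>t\<close>,
  hence at most \<open>(s + t) * ln 2\<close>.\<close>

lemma ent_add:
  assumes "0 \<le> s" "0 \<le> t"
  shows "ent s + ent t - (s + t) * ln 2 \<le> ent (s + t)"
proof (cases "s = 0 \<or> t = 0")
  case True
  then show ?thesis using assms by (auto simp: ent_def)
next
  case False
  then have p: "s > 0" "t > 0" using assms by auto
  have "ln ((s + t) / (2 * s)) \<le> (s + t) / (2 * s) - 1" "ln ((s + t) / (2 * t)) \<le> (s + t) / (2 * t) - 1"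
    using p by (auto intro!: ln_le_minus_one)
  then have "s * ln ((s + t) / (2 * s)) + t * ln ((s + t) / (2 * t))
      \<le> s * ((s + t) / (2 * s) - 1) + t * ((s + t) / (2 * t) - 1)"
    using p by (intro add_mono mult_left_mono) auto
  also have "\<dots> = 0" using p by (simp add: field_simps)
  finally show ?thesis using p by (simp add: ent_def ln_div ln_mult algebra_simps)
qed

text \<open>For tiny \<open>s\<close> the entropy term exceeds the mass \<open>s\<close> by a large
  factor, so that errors proportional to mass can be absorbed into entropy.\<close>

lemma ent_ge:
  assumes "0 \<le> s" "s \<le> (1/2)^n"
  shows "real n * ln 2 * s \<le> ent s"
proof (cases "s = 0")
  case False
  then have p: "s > 0" using assms by auto
  have "ln s \<le> ln ((1/2)^n)" using assms p by (subst ln_le_cancel_iff) auto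
  also have "\<dots> = - (real n * ln 2)" by (simp add: ln_realpow ln_div)
  finally have "real n * ln 2 \<le> ln (1 / s)" using p by (simp add: ln_div)
  then show ?thesis using p by (simp add: ent_def mult.commute mult_left_mono)
qed (simp add: ent_def)

lemma ent_mult_ge: assumes "0 \<le> c" "c \<le> 1" "0 \<le> s" shows "c * ent s \<le> ent (c * s)"
proof (cases "c = 0 \<or> s = 0")
  case False
  then have p: "c > 0" "s > 0" using assms by auto
  have "c * s * ln c \<le> 0" using p assms by (intro mult_nonneg_nonpos) auto
  then show ?thesis using p by (simp add: ent_def ln_div ln_mult algebra_simps)
qed (auto simp: ent_def)

text \<open>The loss in \<open>ent_add\<close> is at most a twentieth of
  \<open>ent s + ent t\<close>, because \<open>ent x \<ge> 20 * ln 2 * x\<close> for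
  \<open>x \<le> \<eta>\<close>; the factor \<open>1 - \<eta>\<close> costs at most another tenth.
  In the application \<open>s\<close> and \<open>t\<close> are masses of single cosets under
  \<open>X\<close> and \<open>Y\<close>, and \<open>u\<close> is the mass of a coset under
  \<open>X - Y\<close>.\<close>

lemma ent_ge_three_quarters:
  assumes \<eta>: "\<eta> = (1/2)^20" and s: "0 \<le> s" "s \<le> \<eta>" and t: "0 \<le> t" "t \<le> \<eta>"
    and u: "(1 - \<eta>) * (s + t) \<le> u" "u \<le> 2 * \<eta>"
  shows "3/4 * (ent s + ent t) \<le> ent u"
proof -
  have e: "0 \<le> \<eta>" "\<eta> \<le> 1/10" "2 * \<eta> \<le> 1/4" unfolding \<eta> by (simp_all add: power_one_over)
  \<comment> \<open>This places \<open>2 * \<eta> \<le> 1/4\<close> below \<open>1/e\<close>, in the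
    range where \<open>ent\<close> increases.\<close>
  have "exp 1 \<le> (3::real)" by (rule exp_le)
  then have "1/4 \<le> exp (-1::real)" by (simp add: exp_minus field_simps)
  have st: "20 * (s * ln 2) \<le> ent s" "20 * (t * ln 2) \<le> ent t"
    using ent_ge[of s 20] ent_ge[of t 20] s t \<eta> by (auto simp: mult_ac)
  moreover have "0 \<le> s * ln 2" "0 \<le> t * ln 2" using s t by auto
  moreover have "ent s + ent t - (s * ln 2 + t * ln 2) \<le> ent (s + t)"
    using ent_add[OF s(1) t(1)] by (simp add: distrib_right)
  moreover have "9/10 * (a + b) \<le> c \<and> 0 \<le> a \<and> 0 \<le> b"
    if "20 * x \<le> a" "20 * y \<le> b" "0 \<le> x" "0 \<le> y" "a + b - (x + y) \<le> c" for a b c x y :: real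
    using that by (simp add: field_simps)
  ultimately have a: "9/10 * (ent s + ent t) \<le> ent (s + t)" "0 \<le> ent s" "0 \<le> ent t"
    by blast+
  have "3/4 * (ent s + ent t) \<le> (9/10) * (9/10 * (ent s + ent t))" using a by simp
  also have "\<dots> \<le> (1 - \<eta>) * (9/10 * (ent s + ent t))"
    using a e by (intro mult_right_mono) auto
  also have "\<dots> \<le> (1 - \<eta>) * ent (s + t)"
    using a e by (intro mult_left_mono) auto
  also have "\<dots> \<le> ent ((1 - \<eta>) * (s + t))"
    using s t e by (intro ent_mult_ge) auto
  also have "\<dots> \<le> ent u"
    using u s t e \<open>1/4 \<le> exp (-1::real)\<close> by (intro ent_mono) auto
  finally show ?thesis .
qed

lemma ent_le: assumes "0 < u" shows "ent u \<le> 1 - u"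
proof -
  have "ln (1 / u) \<le> 1 / u - 1" using assms by (intro ln_le_minus_one) auto
  then have "u * ln (1 / u) \<le> u * (1 / u - 1)" using assms by (intro mult_left_mono) auto
  then show ?thesis using assms by (simp add: ent_def algebra_simps)
qed

lemma ent_nonneg: "0 \<le> u \<Longrightarrow> u \<le> 1 \<Longrightarrow> 0 \<le> ent u"
  by (cases "u = 0") (auto simp: ent_def)

subsection \<open>Divergence and total variation\<close>

text \<open>Meaningful when the support of \<open>P\<close> lies in that of \<open>Q\<close>: where
  \<open>Q\<close> vanishes and \<open>P\<close> does not, division by \<open>0\<close> and
  \<open>ln 0 = 0\<close> give the summand \<open>0\<close> instead of infinity.\<close>

definition kl_div :: "'a pmf \<Rightarrow> 'a pmf \<Rightarrow> real" where
  "kl_div P Q = (\<Sum>x\<in>set_pmf P. pmf P x * ln (pmf P x / pmf Q x))"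

text \<open>Total variation distance at most \<open>d\<close>; phrased by events, it passes to image
  laws at once.\<close>

definition close_pmf :: "'a pmf \<Rightarrow> 'a pmf \<Rightarrow> real \<Rightarrow> bool" where
  "close_pmf P Q d \<longleftrightarrow> (\<forall>A. \<bar>measure_pmf.prob P A - measure_pmf.prob Q A\<bar> \<le> d)"

lemma close_pmf_sym: "close_pmf P Q d \<Longrightarrow> close_pmf Q P d"
  by (simp add: close_pmf_def abs_minus_commute)

lemma close_pmf_trans:
  assumes "close_pmf P Q d" "close_pmf Q R e"
  shows "close_pmf P R (d + e)"
  unfolding close_pmf_def
proof
  fix A
  from assms have "\<bar>measure_pmf.prob P A - measure_pmf.prob Q A\<bar> \<le> d"
    "\<bar>measure_pmf.prob Q A - measure_pmf.prob R A\<bar> \<le> e" by (auto simp: close_pmf_def)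
  then show "\<bar>measure_pmf.prob P A - measure_pmf.prob R A\<bar> \<le> d + e" by linarith
qed

lemma close_pmf_map: "close_pmf P Q d \<Longrightarrow> close_pmf (map_pmf f P) (map_pmf f Q) d"
  by (simp add: close_pmf_def)

lemma close_pmf_mono: "close_pmf P Q d \<Longrightarrow> d \<le> e \<Longrightarrow> close_pmf P Q e"
  unfolding close_pmf_def using order_trans by blast

lemma shannon_entropy_map_inj:
  assumes "inj_on f (set_pmf X)"
  shows "shannon_entropy (map_pmf f X) = shannon_entropy X"
  using assms by (simp add: shannon_entropy_def sum.reindex pmf_map_inj)

lemma pmf_bind_finite:
  assumes "finite (set_pmf Y)"
  shows "pmf (bind_pmf Y K) z = (\<Sum>y\<in>set_pmf Y. pmf Y y * pmf (K y) z)"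
  unfolding pmf_bind
  by (subst integral_measure_pmf_real[OF assms]) (auto simp: mult.commute)

text \<open>The chain rule: the entropy of a mixture is the conditional entropy plus the mutual
  information, and the latter is the mean divergence of the fibres from the mixture.\<close>

lemma shannon_entropy_bind:
  assumes fY: "finite (set_pmf Y)" and fK: "\<And>y. y \<in> set_pmf Y \<Longrightarrow> finite (set_pmf (K y))"
  shows "shannon_entropy (bind_pmf Y K) =
    (\<Sum>y\<in>set_pmf Y. pmf Y y * (shannon_entropy (K y) + kl_div (K y) (bind_pmf Y K)))"
proof -
  let ?R = "bind_pmf Y K"
  have fR: "finite (set_pmf ?R)" using assms by auto
  have *: "shannon_entropy (K y) + kl_div (K y) ?R
      = (\<Sum>z\<in>set_pmf ?R. pmf (K y) z * ln (1 / pmf ?R z))" if y: "y \<in> set_pmf Y" for y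
  proof -
    have "shannon_entropy (K y) + kl_div (K y) ?R =
      (\<Sum>z\<in>set_pmf (K y). pmf (K y) z * ln (1 / pmf (K y) z) + pmf (K y) z * ln (pmf (K y) z / pmf ?R z))"
      by (simp add: shannon_entropy_def kl_div_def sum.distrib)
    also have "\<dots> = (\<Sum>z\<in>set_pmf (K y). pmf (K y) z * ln (1 / pmf ?R z))"
    proof (rule sum.cong[OF refl])
      fix z assume z: "z \<in> set_pmf (K y)"
      then have "z \<in> set_pmf ?R" using y by auto
      then have "pmf ?R z > 0" "pmf (K y) z > 0" using z by (auto simp: pmf_positive)
      then show "pmf (K y) z * ln (1 / pmf (K y) z) + pmf (K y) z * ln (pmf (K y) z / pmf ?R z)
        = pmf (K y) z * ln (1 / pmf ?R z)"
        by (simp add: ln_div algebra_simps)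
    qed
    also have "\<dots> = (\<Sum>z\<in>set_pmf ?R. pmf (K y) z * ln (1 / pmf ?R z))"
      using y fR by (intro sum.mono_neutral_left) (auto simp: set_pmf_iff)
    finally show ?thesis .
  qed
  have "shannon_entropy ?R
      = (\<Sum>z\<in>set_pmf ?R. \<Sum>y\<in>set_pmf Y. pmf Y y * pmf (K y) z * ln (1 / pmf ?R z))"
    unfolding shannon_entropy_def by (simp only: pmf_bind_finite[OF fY] sum_distrib_right)
  also have "\<dots> = (\<Sum>y\<in>set_pmf Y. \<Sum>z\<in>set_pmf ?R. pmf Y y * pmf (K y) z * ln (1 / pmf ?R z))"
    by (rule sum.swap)
  also have "\<dots> = (\<Sum>y\<in>set_pmf Y. pmf Y y * (\<Sum>z\<in>set_pmf ?R. pmf (K y) z * ln (1 / pmf ?R z)))"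
    by (simp add: sum_distrib_left mult.assoc)
  also have "\<dots> = (\<Sum>y\<in>set_pmf Y. pmf Y y * (shannon_entropy (K y) + kl_div (K y) ?R))"
    using * by (intro sum.cong) auto
  finally show ?thesis .
qed

text \<open>An event and its complement have the same discrepancy, and together they use each point
  of the \<open>l1\<close> sum once; this gives the factor \<open>1/2\<close>.\<close>

lemma prob_diff_le_half_l1:
  assumes S: "finite S" "set_pmf P \<subseteq> S" "set_pmf Q \<subseteq> S"
  shows "\<bar>measure_pmf.prob P A - measure_pmf.prob Q A\<bar> \<le> (\<Sum>x\<in>S. \<bar>pmf P x - pmf Q x\<bar>) / 2"
proof -
  have pr: "measure_pmf.prob R B = (\<Sum>x\<in>S\<inter>B. pmf R x)" if "set_pmf R \<subseteq> S" for R B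
  proof -
    have "measure_pmf.prob R B = measure_pmf.prob R (S \<inter> B)"
      using that by (intro measure_eq_AE) (auto simp: AE_measure_pmf_iff)
    then show ?thesis using S by (simp add: measure_measure_pmf_finite)
  qed
  have b: "\<bar>measure_pmf.prob P B - measure_pmf.prob Q B\<bar> \<le> (\<Sum>x\<in>S\<inter>B. \<bar>pmf P x - pmf Q x\<bar>)" for B
    using S by (simp add: pr sum_subtractf[symmetric])
  have "\<bar>measure_pmf.prob P (-A) - measure_pmf.prob Q (-A)\<bar> = \<bar>measure_pmf.prob P A - measure_pmf.prob Q A\<bar>"
    using measure_pmf.prob_compl[of A P] measure_pmf.prob_compl[of A Q] by (simp add: Compl_eq_Diff_UNIV)
  then have "2 * \<bar>measure_pmf.prob P A - measure_pmf.prob Q A\<bar>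
      = \<bar>measure_pmf.prob P A - measure_pmf.prob Q A\<bar> + \<bar>measure_pmf.prob P (-A) - measure_pmf.prob Q (-A)\<bar>"
    by simp
  also have "\<dots> \<le> (\<Sum>x\<in>S\<inter>A. \<bar>pmf P x - pmf Q x\<bar>) + (\<Sum>x\<in>S\<inter>-A. \<bar>pmf P x - pmf Q x\<bar>)"
    by (intro add_mono b)
  also have "\<dots> = (\<Sum>x\<in>S. \<bar>pmf P x - pmf Q x\<bar>)"
    using S by (subst sum.union_disjoint[symmetric]) (auto intro!: sum.cong)
  finally show ?thesis by simp
qed

text \<open>Split by the sign of the difference, the \<open>l1\<close> sum consists of the
  discrepancies of two events.\<close>

lemma l1_le_of_close_pmf:
  assumes S: "finite S" "set_pmf P \<subseteq> S" "set_pmf Q \<subseteq> S" and c: "close_pmf P Q d"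
  shows "(\<Sum>x\<in>S. \<bar>pmf P x - pmf Q x\<bar>) \<le> 2 * d"
proof -
  define A where "A = {x\<in>S. pmf P x \<ge> pmf Q x}"
  define B where "B = {x\<in>S. pmf P x < pmf Q x}"
  have fin: "finite A" "finite B" using S by (auto simp: A_def B_def)
  have "S = A \<union> B" "A \<inter> B = {}" by (auto simp: A_def B_def)
  then have "(\<Sum>x\<in>S. \<bar>pmf P x - pmf Q x\<bar>) = (\<Sum>x\<in>A. \<bar>pmf P x - pmf Q x\<bar>) + (\<Sum>x\<in>B. \<bar>pmf P x - pmf Q x\<bar>)"
    using fin by (simp add: sum.union_disjoint)
  also have "(\<Sum>x\<in>A. \<bar>pmf P x - pmf Q x\<bar>) = measure_pmf.prob P A - measure_pmf.prob Q A"
    using fin by (simp add: measure_measure_pmf_finite sum_subtractf[symmetric] A_def)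
  also have "(\<Sum>x\<in>B. \<bar>pmf P x - pmf Q x\<bar>) = measure_pmf.prob Q B - measure_pmf.prob P B"
    using fin by (simp add: measure_measure_pmf_finite sum_subtractf[symmetric] B_def)
  finally show ?thesis using c[unfolded close_pmf_def, rule_format, of A] c[unfolded close_pmf_def, rule_format, of B]
    by linarith
qed

text \<open>Pinsker with a worse constant: the divergence dominates the squared Hellinger distance.\<close>

lemma prob_diff_square_le_kl_div:
  assumes fQ: "finite (set_pmf Q)" and PQ: "set_pmf P \<subseteq> set_pmf Q"
  shows "(measure_pmf.prob P A - measure_pmf.prob Q A)\<^sup>2 \<le> kl_div P Q"
proof -
  let ?S = "set_pmf Q"
  let ?h = "\<Sum>x\<in>?S. (sqrt (pmf P x) - sqrt (pmf Q x))\<^sup>2"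
  let ?k = "\<Sum>x\<in>?S. (sqrt (pmf P x) + sqrt (pmf Q x))\<^sup>2"
  have sP: "(\<Sum>x\<in>?S. pmf P x) = 1" and sQ: "(\<Sum>x\<in>?S. pmf Q x) = 1"
    using fQ PQ by (auto intro!: sum_pmf_eq_1)
  have sq: "(sqrt (pmf P x) - sqrt (pmf Q x))\<^sup>2 = pmf P x + pmf Q x - 2 * sqrt (pmf P x * pmf Q x)" for x
    by (simp add: power2_diff real_sqrt_mult)
  have h: "?h = 2 - 2 * (\<Sum>x\<in>?S. sqrt (pmf P x * pmf Q x))"
    by (simp only: sq sum_subtractf sum.distrib sP sQ sum_distrib_left[symmetric])
  have "?k \<le> (\<Sum>x\<in>?S. 2 * pmf P x + 2 * pmf Q x)"
  proof (rule sum_mono)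
    fix x
    have "0 \<le> (sqrt (pmf P x) - sqrt (pmf Q x))\<^sup>2" by simp
    then show "(sqrt (pmf P x) + sqrt (pmf Q x))\<^sup>2 \<le> 2 * pmf P x + 2 * pmf Q x"
      unfolding power2_diff power2_sum by simp
  qed
  also have "\<dots> = 4" by (simp add: sum.distrib sum_distrib_left[symmetric] sP sQ)
  finally have k: "?k \<le> 4" .
  have "2 - 2 * (\<Sum>x\<in>?S. sqrt (pmf P x * pmf Q x)) \<le> kl_div P Q"
  proof -
    have "2 - 2 * (\<Sum>x\<in>?S. sqrt (pmf P x * pmf Q x)) = (\<Sum>x\<in>?S. 2 * pmf P x - 2 * sqrt (pmf P x * pmf Q x))"
      by (simp add: sum_subtractf sum_distrib_left[symmetric] sP)
    also have "\<dots> = (\<Sum>x\<in>set_pmf P. 2 * pmf P x - 2 * sqrt (pmf P x * pmf Q x))"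
      using fQ PQ by (intro sum.mono_neutral_right) (auto simp: set_pmf_iff)
    also have "\<dots> \<le> kl_div P Q" unfolding kl_div_def
    proof (rule sum_mono)
      fix x assume x: "x \<in> set_pmf P"
      then have p: "pmf P x > 0" "pmf Q x > 0" using PQ by (auto simp: pmf_positive)
      \<comment> \<open>Taking the root before applying \<open>ln y \<le> y - 1\<close> is what
        produces the Hellinger distance; without the root the bound would only give
        nonnegativity.\<close>
      have "ln (pmf Q x / pmf P x) = 2 * ln (sqrt (pmf Q x / pmf P x))"
        using p by (simp add: ln_sqrt)
      also have "\<dots> \<le> 2 * (sqrt (pmf Q x / pmf P x) - 1)"
        using p by (intro mult_left_mono ln_le_minus_one) auto
      finally have "ln (pmf P x / pmf Q x) \<ge> 2 * (1 - sqrt (pmf Q x / pmf P x))"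
        using p by (simp add: ln_div)
      then have "pmf P x * ln (pmf P x / pmf Q x) \<ge> pmf P x * (2 * (1 - sqrt (pmf Q x / pmf P x)))"
        using p by (intro mult_left_mono) auto
      moreover have "pmf P x * sqrt (pmf Q x / pmf P x) = sqrt (pmf P x * pmf Q x)"
      proof -
        have "pmf P x * sqrt (pmf Q x / pmf P x) = sqrt ((pmf P x)\<^sup>2 * (pmf Q x / pmf P x))"
          using p by (simp add: real_sqrt_mult del: times_divide_eq_right)
        also have "(pmf P x)\<^sup>2 * (pmf Q x / pmf P x) = pmf P x * pmf Q x"
          using p by (simp add: power2_eq_square)
        finally show ?thesis .
      qed
      ultimately show "2 * pmf P x - 2 * sqrt (pmf P x * pmf Q x) \<le> pmf P x * ln (pmf P x / pmf Q x)"
        by (simp add: algebra_simps)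
    qed
    finally show ?thesis .
  qed
  then have hk: "?h \<le> kl_div P Q" using h by simp
  \<comment> \<open>Cauchy-Schwarz for this factorisation bounds the squared \<open>l1\<close>
    distance by \<open>4\<close> times the squared Hellinger distance \<open>?h\<close>.\<close>
  have "\<bar>pmf P x - pmf Q x\<bar> = \<bar>sqrt (pmf P x) - sqrt (pmf Q x)\<bar> * (sqrt (pmf P x) + sqrt (pmf Q x))" for x
  proof -
    have "pmf P x - pmf Q x = (sqrt (pmf P x) - sqrt (pmf Q x)) * (sqrt (pmf P x) + sqrt (pmf Q x))"
      by (simp add: algebra_simps)
    then show ?thesis by (simp add: abs_mult)
  qed
  then have "(\<Sum>x\<in>?S. \<bar>pmf P x - pmf Q x\<bar>)\<^sup>2
    = (\<Sum>x\<in>?S. \<bar>sqrt (pmf P x) - sqrt (pmf Q x)\<bar> * (sqrt (pmf P x) + sqrt (pmf Q x)))\<^sup>2" by simp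
  also have "\<dots> \<le> (\<Sum>x\<in>?S. \<bar>sqrt (pmf P x) - sqrt (pmf Q x)\<bar>\<^sup>2) * ?k"
    by (rule Cauchy_Schwarz_ineq_sum)
  also have "\<dots> \<le> ?h * 4" using k by (intro mult_mono sum_nonneg) auto
  finally have c: "(\<Sum>x\<in>?S. \<bar>pmf P x - pmf Q x\<bar>)\<^sup>2 \<le> 4 * ?h" by simp
  have "\<bar>measure_pmf.prob P A - measure_pmf.prob Q A\<bar>\<^sup>2 \<le> ((\<Sum>x\<in>?S. \<bar>pmf P x - pmf Q x\<bar>) / 2)\<^sup>2"
    by (intro power_mono prob_diff_le_half_l1 fQ PQ) auto
  also have "\<dots> \<le> ?h" using c by (simp add: power_divide)
  finally show ?thesis using hk by simp
qed

lemma kl_div_nonneg: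
  assumes "finite (set_pmf Q)" "set_pmf P \<subseteq> set_pmf Q"
  shows "0 \<le> kl_div P Q"
  using prob_diff_square_le_kl_div[OF assms] by (meson zero_le_power2 order_trans)

text \<open>As all fibres have entropy \<open>h\<close>, the mean divergence of the fibres from the
  mixture is at most \<open>e\<close>. By Pinsker a fibre that is not \<open>d\<close>-close has
  divergence at least \<open>d^2\<close>, and Markov's inequality applies.\<close>

lemma prob_close_pmf_bind:
  assumes fY: "finite (set_pmf Y)" and fK: "\<And>y. y \<in> set_pmf Y \<Longrightarrow> finite (set_pmf (K y))"
    and hK: "\<And>y. y \<in> set_pmf Y \<Longrightarrow> shannon_entropy (K y) = h"
    and e: "shannon_entropy (bind_pmf Y K) \<le> h + e" and d: "d > 0"
  shows "measure_pmf.prob Y {y \<in> set_pmf Y. close_pmf (K y) (bind_pmf Y K) d} \<ge> 1 - e / d\<^sup>2"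
proof -
  let ?R = "bind_pmf Y K"
  let ?D = "\<lambda>y. kl_div (K y) ?R"
  define B where "B = {y \<in> set_pmf Y. \<not> close_pmf (K y) ?R d}"
  have fB: "finite B" and BY: "B \<subseteq> set_pmf Y" using fY by (auto simp: B_def)
  have fR: "finite (set_pmf ?R)" using fY fK by auto
  have D0: "?D y \<ge> 0" if "y \<in> set_pmf Y" for y
    using that fR by (intro kl_div_nonneg) auto
  have "shannon_entropy ?R = (\<Sum>y\<in>set_pmf Y. pmf Y y * (h + ?D y))"
    using shannon_entropy_bind[OF fY fK] hK by simp
  also have "\<dots> = h + (\<Sum>y\<in>set_pmf Y. pmf Y y * ?D y)"
    using sum_pmf_eq_1[OF fY] by (simp add: distrib_left sum.distrib sum_distrib_right[symmetric])
  finally have s: "(\<Sum>y\<in>set_pmf Y. pmf Y y * ?D y) \<le> e" using e by simp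
  have DB: "?D y \<ge> d\<^sup>2" if y: "y \<in> B" for y
  proof -
    from y obtain A where "\<bar>measure_pmf.prob (K y) A - measure_pmf.prob ?R A\<bar> > d"
      by (auto simp: B_def close_pmf_def not_le)
    then have "\<bar>measure_pmf.prob (K y) A - measure_pmf.prob ?R A\<bar>\<^sup>2 \<ge> d\<^sup>2"
      using d by (intro power_mono) auto
    then have "(measure_pmf.prob (K y) A - measure_pmf.prob ?R A)\<^sup>2 \<ge> d\<^sup>2" by simp
    moreover have "set_pmf (K y) \<subseteq> set_pmf ?R" using y BY by auto
    ultimately show ?thesis using prob_diff_square_le_kl_div[OF fR, of "K y" A] by linarith
  qed
  have "d\<^sup>2 * measure_pmf.prob Y B = (\<Sum>y\<in>B. pmf Y y * d\<^sup>2)"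
    using fB by (simp add: measure_measure_pmf_finite sum_distrib_right mult.commute)
  also have "\<dots> \<le> (\<Sum>y\<in>B. pmf Y y * ?D y)" by (intro sum_mono mult_left_mono DB) auto
  also have "\<dots> \<le> (\<Sum>y\<in>set_pmf Y. pmf Y y * ?D y)"
    using fY BY D0 by (intro sum_mono2) auto
  finally have "d\<^sup>2 * measure_pmf.prob Y B \<le> e" using s by simp
  then have "measure_pmf.prob Y B \<le> e / d\<^sup>2" using d by (simp add: field_simps)
  moreover have "measure_pmf.prob Y {y \<in> set_pmf Y. close_pmf (K y) ?R d} = measure_pmf.prob Y (- B)"
    by (intro measure_eq_AE) (auto simp: AE_measure_pmf_iff B_def)
  moreover have "\<dots> = 1 - measure_pmf.prob Y B"
    using measure_pmf.prob_compl[of B Y] by (simp add: Compl_eq_Diff_UNIV)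
  ultimately show ?thesis by simp
qed

subsection \<open>The subgroup of almost-periods\<close>

locale abelian_group_law = comm_group G for G :: "'a monoid" (structure)
begin

definition shift :: "'a \<Rightarrow> 'a pmf \<Rightarrow> 'a pmf" where
  "shift h X = map_pmf (\<lambda>x. x \<otimes> h) X"

lemma shift_shift:
  assumes "set_pmf X \<subseteq> carrier G" "h \<in> carrier G" "k \<in> carrier G"
  shows "shift h (shift k X) = shift (k \<otimes> h) X"
  unfolding shift_def pmf.map_comp using assms by (intro pmf.map_cong) (auto simp: m_assoc)

lemma shift_one: "set_pmf X \<subseteq> carrier G \<Longrightarrow> shift \<one> X = X"
  unfolding shift_def by (rule map_pmf_idI) auto

lemma close_shift_mult:
  assumes X: "set_pmf X \<subseteq> carrier G" and h: "h \<in> carrier G" and k: "k \<in> carrier G"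
    and c: "close_pmf X (shift h X) d" "close_pmf X (shift k X) e"
  shows "close_pmf X (shift (h \<otimes> k) X) (d + e)"
proof -
  have "close_pmf (shift k X) (shift k (shift h X)) d"
    using c(1) unfolding shift_def[of k] by (rule close_pmf_map)
  then have "close_pmf X (shift k (shift h X)) (e + d)" by (rule close_pmf_trans[OF c(2)])
  then show ?thesis using X h k by (simp add: shift_shift add.commute)
qed

lemma close_shift_inv:
  assumes X: "set_pmf X \<subseteq> carrier G" and h: "h \<in> carrier G"
    and c: "close_pmf X (shift h X) d"
  shows "close_pmf X (shift (inv h) X) d"
proof -
  have "close_pmf (shift (inv h) X) (shift (inv h) (shift h X)) d"
    using c unfolding shift_def[of "inv h"] by (rule close_pmf_map)
  then show ?thesis using X h by (simp add: shift_shift shift_one close_pmf_sym)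
qed

text \<open>Under \<open>X\<close> the set \<open>S\<close> has mass above \<open>3/4\<close>, and
  its preimage under translation by \<open>h\<close> has mass above \<open>1/4\<close>. So the two
  meet: some \<open>x\<close> in \<open>S\<close> is moved by \<open>h\<close> into
  \<open>S\<close>, which makes \<open>h\<close> a difference of elements of
  \<open>S\<close>.\<close>

lemma close_shift_transfer:
  assumes X: "set_pmf X \<subseteq> carrier G" and h: "h \<in> carrier G"
    and S: "S \<subseteq> set_pmf X" "measure_pmf.prob X S > 3/4"
    and c: "close_pmf X (shift h X) (1/2)"
    and *: "\<And>x x'. x \<in> S \<Longrightarrow> x' \<in> S \<Longrightarrow> close_pmf Y (shift (x' \<otimes> inv x) Y) d"
  shows "close_pmf Y (shift h Y) d" "\<exists>x\<in>S. \<exists>x'\<in>S. h = x' \<otimes> inv x"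
proof -
  have "measure_pmf.prob X S - measure_pmf.prob (shift h X) S \<le> 1/2"
    using c unfolding close_pmf_def by (metis abs_le_D1)
  then have "measure_pmf.prob X ((\<lambda>x. x \<otimes> h) -` S) > 1/4"
    using S by (simp add: shift_def)
  moreover have "S \<inter> (\<lambda>x. x \<otimes> h) -` S = {} \<Longrightarrow>
      measure_pmf.prob X S + measure_pmf.prob X ((\<lambda>x. x \<otimes> h) -` S) \<le> 1"
    by (subst measure_pmf.finite_measure_Union[symmetric]) auto
  ultimately have "S \<inter> (\<lambda>x. x \<otimes> h) -` S \<noteq> {}" using S by linarith
  then obtain x where x: "x \<in> S" "x \<otimes> h \<in> S" by auto
  then have "x \<in> carrier G" using S X by auto
  then have eq: "h = x \<otimes> h \<otimes> inv x" using h by (simp add: m_comm[of x h] m_assoc)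
  then show "\<exists>x\<in>S. \<exists>x'\<in>S. h = x' \<otimes> inv x" using x by blast
  show "close_pmf Y (shift h Y) d" using *[OF x] eq by simp
qed

text \<open>An almost-period of \<open>X\<close> at the crude level \<open>1/2\<close> is a difference of two typical values of \<open>X\<close>, hence an
  almost-period of \<open>Y\<close> at level \<open>d\<close>, hence in turn one of \<open>X\<close> at level \<open>d\<close>. This gap makes the set
  of almost-periods closed under the group operation.\<close>

lemma exists_almost_stabilizer:
  assumes X: "group_valued G X" and Y: "group_valued G Y"
    and S: "S \<subseteq> set_pmf X" "measure_pmf.prob X S > 3/4"
    and T: "T \<subseteq> set_pmf Y" "measure_pmf.prob Y T > 3/4"
    and SY: "\<And>x x'. x \<in> S \<Longrightarrow> x' \<in> S \<Longrightarrow> close_pmf Y (shift (x' \<otimes> inv x) Y) d"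
    and TX: "\<And>y y'. y \<in> T \<Longrightarrow> y' \<in> T \<Longrightarrow> close_pmf X (shift (y' \<otimes> inv y) X) d"
    and d: "d \<le> 1/4"
  shows "\<exists>H. subgroup H G \<and> finite H \<and>
    (\<forall>h\<in>H. close_pmf X (shift h X) d) \<and> (\<forall>h\<in>H. close_pmf Y (shift h Y) d) \<and>
    (\<forall>x\<in>S. \<forall>x'\<in>S. x' \<otimes> inv x \<in> H) \<and> (\<forall>y\<in>T. \<forall>y'\<in>T. y' \<otimes> inv y \<in> H)"
proof -
  have Xc: "set_pmf X \<subseteq> carrier G" "finite (set_pmf X)" and Yc: "set_pmf Y \<subseteq> carrier G"
    using X Y by (auto simp: group_valued_def)
  define H where "H = {h \<in> carrier G. close_pmf X (shift h X) (1/2)}"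
  have HY: "close_pmf Y (shift h Y) d" if "h \<in> H" for h
    using that close_shift_transfer(1)[OF Xc(1) _ S _ SY] by (auto simp: H_def)
  have HX: "close_pmf X (shift h X) d" if h: "h \<in> H" for h
  proof -
    have "close_pmf Y (shift h Y) (1/2)" using HY[OF h] d by (auto intro: close_pmf_mono)
    then show ?thesis using h close_shift_transfer(1)[OF Yc _ T _ TX] by (auto simp: H_def)
  qed
  have "subgroup H G"
  proof (rule subgroupI)
    show "H \<subseteq> carrier G" by (auto simp: H_def)
    have "\<one> \<in> H" using Xc by (simp add: H_def shift_one close_pmf_def)
    then show "H \<noteq> {}" by auto
    show "inv a \<in> H" if "a \<in> H" for a
      using that Xc by (auto simp: H_def intro: close_shift_inv)
    show "a \<otimes> b \<in> H" if ab: "a \<in> H" "b \<in> H" for a b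
    proof -
      \<comment> \<open>Both factors have improved to level \<open>d\<close>, and
        \<open>d + d \<le> 1/2\<close> is again the level in the definition of
        \<open>H\<close>.\<close>
      have "close_pmf X (shift (a \<otimes> b) X) (d + d)"
        using ab HX Xc by (intro close_shift_mult) (auto simp: H_def)
      then show ?thesis using d ab by (auto simp: H_def intro: close_pmf_mono)
    qed
  qed
  moreover have "finite H"
  proof (rule finite_subset)
    show "H \<subseteq> (\<lambda>(x, x'). x' \<otimes> inv x) ` (set_pmf X \<times> set_pmf X)"
    proof
      fix h assume "h \<in> H"
      then obtain x x' where "x \<in> S" "x' \<in> S" "h = x' \<otimes> inv x"
        using close_shift_transfer(2)[OF Xc(1) _ S _ SY] unfolding H_def by blast
      then show "h \<in> (\<lambda>(x, x'). x' \<otimes> inv x) ` (set_pmf X \<times> set_pmf X)" using S(1) by force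
    qed
  qed (use Xc in auto)
  moreover have "y' \<otimes> inv y \<in> H" if "y \<in> T" "y' \<in> T" for y y'
    using TX[OF that] that T(1) Yc d by (auto simp: H_def intro: close_pmf_mono)
  moreover have "x' \<otimes> inv x \<in> H" if x: "x \<in> S" "x' \<in> S" for x x'
  proof -
    have c: "x' \<otimes> inv x \<in> carrier G" using x S(1) Xc by auto
    have "close_pmf Y (shift (x' \<otimes> inv x) Y) (1/2)"
      using SY[OF x] d by (auto intro: close_pmf_mono)
    then have "close_pmf X (shift (x' \<otimes> inv x) X) d"
      using c close_shift_transfer(1)[OF Yc _ T _ TX] by auto
    then show ?thesis using c d by (auto simp: H_def intro: close_pmf_mono)
  qed
  ultimately show ?thesis using HX HY by blast
qed

section \<open>Fibres and entropy of a difference\<close>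

lemma diff_pmf_eq_bind_right: "diff_pmf G X Y = bind_pmf Y (\<lambda>y. map_pmf (\<lambda>x. x \<otimes> inv y) X)"
  unfolding diff_pmf_def pair_pmf_def map_pmf_def
  by (subst bind_commute_pmf) (simp add: bind_assoc_pmf bind_return_pmf)

lemma diff_pmf_eq_bind_left: "diff_pmf G X Y = bind_pmf X (\<lambda>x. map_pmf (\<lambda>y. x \<otimes> inv y) Y)"
  unfolding diff_pmf_def pair_pmf_def map_pmf_def
  by (simp add: bind_assoc_pmf bind_return_pmf)

lemma group_valued_diff:
  "group_valued G X \<Longrightarrow> group_valued G Y \<Longrightarrow> group_valued G (diff_pmf G X Y)"
  by (auto simp: group_valued_def diff_pmf_def)

lemma entropy_right_fibre:
  "set_pmf X \<subseteq> carrier G \<Longrightarrow> y \<in> carrier G \<Longrightarrow>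
    shannon_entropy (map_pmf (\<lambda>x. x \<otimes> inv y) X) = shannon_entropy X"
  by (intro shannon_entropy_map_inj inj_onI) (auto simp: subset_iff)

lemma entropy_left_fibre:
  "set_pmf Y \<subseteq> carrier G \<Longrightarrow> x \<in> carrier G \<Longrightarrow>
    shannon_entropy (map_pmf (\<lambda>y. x \<otimes> inv y) Y) = shannon_entropy Y"
  by (intro shannon_entropy_map_inj inj_onI) (auto simp: subset_iff inv_inj[THEN inj_on_eq_iff])

text \<open>Fixing one variable leaves a translate, possibly reflected, of the other, with the same
  entropy; the chain rule adds a mean of nonnegative divergences.\<close>

lemma entropy_diff_ge:
  assumes X: "group_valued G X" and Y: "group_valued G Y"
  shows "shannon_entropy X \<le> shannon_entropy (diff_pmf G X Y)"
    "shannon_entropy Y \<le> shannon_entropy (diff_pmf G X Y)"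
proof -
  have c: "finite (set_pmf X)" "set_pmf X \<subseteq> carrier G" "finite (set_pmf Y)" "set_pmf Y \<subseteq> carrier G"
    using X Y by (auto simp: group_valued_def)
  have *: "h \<le> shannon_entropy (bind_pmf P K)"
    if "finite (set_pmf P)" "\<And>y. y \<in> set_pmf P \<Longrightarrow> finite (set_pmf (K y))"
      "\<And>y. y \<in> set_pmf P \<Longrightarrow> shannon_entropy (K y) = h" for P and K :: "'a \<Rightarrow> 'a pmf" and h
  proof -
    have "h = (\<Sum>y\<in>set_pmf P. pmf P y * h)"
      using sum_pmf_eq_1[OF that(1)] by (simp add: sum_distrib_right[symmetric])
    also have "\<dots> \<le> (\<Sum>y\<in>set_pmf P. pmf P y * (shannon_entropy (K y) + kl_div (K y) (bind_pmf P K)))"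
    proof (intro sum_mono mult_left_mono)
      fix y assume y: "y \<in> set_pmf P"
      then have "0 \<le> kl_div (K y) (bind_pmf P K)" using that by (intro kl_div_nonneg) auto
      then show "h \<le> shannon_entropy (K y) + kl_div (K y) (bind_pmf P K)" using that(3)[OF y] by simp
    qed auto
    also have "\<dots> = shannon_entropy (bind_pmf P K)"
      using that by (intro shannon_entropy_bind[symmetric]) auto
    finally show ?thesis .
  qed
  show "shannon_entropy X \<le> shannon_entropy (diff_pmf G X Y)"
    unfolding diff_pmf_eq_bind_right using c by (intro *) (auto intro!: entropy_right_fibre)
  show "shannon_entropy Y \<le> shannon_entropy (diff_pmf G X Y)"
    unfolding diff_pmf_eq_bind_left using c by (intro *) (auto intro!: entropy_left_fibre)
qed

lemma small_ruzsa_dist_almost_stabilizer: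
  assumes X: "group_valued G X" and Y: "group_valued G Y"
    and e: "ruzsa_dist G X Y \<le> e" and d: "0 < d" "d \<le> 1/8" and eta: "2 * e / d\<^sup>2 \<le> \<eta>" "\<eta> < 1/4"
  shows "\<exists>H x\<^sub>0 y\<^sub>0. subgroup H G \<and> finite H \<and> x\<^sub>0 \<in> carrier G \<and> y\<^sub>0 \<in> carrier G \<and>
    (\<forall>h\<in>H. close_pmf X (shift h X) (2*d)) \<and> (\<forall>h\<in>H. close_pmf Y (shift h Y) (2*d)) \<and>
    measure_pmf.prob X {x \<in> carrier G. x \<otimes> inv x\<^sub>0 \<in> H} \<ge> 1 - \<eta> \<and>
    measure_pmf.prob Y {y \<in> carrier G. y \<otimes> inv y\<^sub>0 \<in> H} \<ge> 1 - \<eta>"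
proof -
  have Xc: "finite (set_pmf X)" "set_pmf X \<subseteq> carrier G"
    and Yc: "finite (set_pmf Y)" "set_pmf Y \<subseteq> carrier G"
    using X Y by (auto simp: group_valued_def)
  let ?R = "diff_pmf G X Y"
  define S where "S = {x \<in> set_pmf X. close_pmf (map_pmf (\<lambda>y. x \<otimes> inv y) Y) ?R d}"
  define T where "T = {y \<in> set_pmf Y. close_pmf (map_pmf (\<lambda>x. x \<otimes> inv y) X) ?R d}"
  \<comment> \<open>The distance is the mean of the two entropy excesses, which are nonnegative;
    hence each is at most \<open>2 * e\<close>.\<close>
  have R: "shannon_entropy ?R \<le> shannon_entropy X + 2 * e" "shannon_entropy ?R \<le> shannon_entropy Y + 2 * e"
    using e entropy_diff_ge[OF X Y] unfolding ruzsa_dist_def by linarith+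
  have "measure_pmf.prob X S \<ge> 1 - 2 * e / d\<^sup>2"
    unfolding S_def diff_pmf_eq_bind_left using R(2) Xc Yc d
    by (intro prob_close_pmf_bind[where h = "shannon_entropy Y"])
      (auto intro!: entropy_left_fibre simp: diff_pmf_eq_bind_left)
  then have S: "measure_pmf.prob X S \<ge> 1 - \<eta>" using eta by linarith
  have "measure_pmf.prob Y T \<ge> 1 - 2 * e / d\<^sup>2"
    unfolding T_def diff_pmf_eq_bind_right using R(1) Xc Yc d
    by (intro prob_close_pmf_bind[where h = "shannon_entropy X"])
      (auto intro!: entropy_right_fibre simp: diff_pmf_eq_bind_right)
  then have T: "measure_pmf.prob Y T \<ge> 1 - \<eta>" using eta by linarith
  have SY: "close_pmf Y (shift (x' \<otimes> inv x) Y) (2*d)" if x: "x \<in> S" "x' \<in> S" for x x'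
  proof -
    have xc: "x \<in> carrier G" "x' \<in> carrier G" using x Xc by (auto simp: S_def)
    have "close_pmf (map_pmf (\<lambda>y. x' \<otimes> inv y) Y) (map_pmf (\<lambda>y. x \<otimes> inv y) Y) (d + d)"
      using x by (intro close_pmf_trans[of _ ?R]) (auto simp: S_def intro: close_pmf_sym)
    \<comment> \<open>In additive notation, the reflection \<open>z \<mapsto> x' - z\<close> turns
      the fibre \<open>x' - Y\<close> into \<open>Y\<close> and the fibre \<open>x - Y\<close> into
      \<open>Y + (x' - x)\<close>.\<close>
    then have "close_pmf (map_pmf (\<lambda>z. inv z \<otimes> x') (map_pmf (\<lambda>y. x' \<otimes> inv y) Y))
       (map_pmf (\<lambda>z. inv z \<otimes> x') (map_pmf (\<lambda>y. x \<otimes> inv y) Y)) (d + d)" by (rule close_pmf_map)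
    also have "map_pmf (\<lambda>z. inv z \<otimes> x') (map_pmf (\<lambda>y. x' \<otimes> inv y) Y) = Y"
      unfolding pmf.map_comp
    proof (rule map_pmf_idI)
      fix y assume "y \<in> set_pmf Y"
      then show "((\<lambda>z. inv z \<otimes> x') \<circ> (\<lambda>y. x' \<otimes> inv y)) y = y"
        using Yc xc by (auto simp: inv_mult_group m_assoc subset_iff)
    qed
    also have "map_pmf (\<lambda>z. inv z \<otimes> x') (map_pmf (\<lambda>y. x \<otimes> inv y) Y) = shift (x' \<otimes> inv x) Y"
      unfolding pmf.map_comp shift_def
    proof (rule pmf.map_cong[OF refl])
      fix y assume "y \<in> set_pmf Y"
      then show "((\<lambda>z. inv z \<otimes> x') \<circ> (\<lambda>y. x \<otimes> inv y)) y = y \<otimes> (x' \<otimes> inv x)"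
        using Yc xc by (auto simp: inv_mult_group m_ac subset_iff)
    qed
    finally show ?thesis by simp
  qed
  have TX: "close_pmf X (shift (y' \<otimes> inv y) X) (2*d)" if y: "y \<in> T" "y' \<in> T" for y y'
  proof -
    have yc: "y \<in> carrier G" "y' \<in> carrier G" using y Yc by (auto simp: T_def)
    have "close_pmf (map_pmf (\<lambda>x. x \<otimes> inv y') X) (map_pmf (\<lambda>x. x \<otimes> inv y) X) (d + d)"
      using y by (intro close_pmf_trans[of _ ?R]) (auto simp: T_def intro: close_pmf_sym)
    then have "close_pmf (map_pmf (\<lambda>z. z \<otimes> y') (map_pmf (\<lambda>x. x \<otimes> inv y') X))
       (map_pmf (\<lambda>z. z \<otimes> y') (map_pmf (\<lambda>x. x \<otimes> inv y) X)) (d + d)" by (rule close_pmf_map)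
    also have "map_pmf (\<lambda>z. z \<otimes> y') (map_pmf (\<lambda>x. x \<otimes> inv y') X) = X"
      unfolding pmf.map_comp
    proof (rule map_pmf_idI)
      fix x assume "x \<in> set_pmf X"
      then show "((\<lambda>z. z \<otimes> y') \<circ> (\<lambda>x. x \<otimes> inv y')) x = x"
        using Xc yc by (auto simp: m_assoc subset_iff)
    qed
    also have "map_pmf (\<lambda>z. z \<otimes> y') (map_pmf (\<lambda>x. x \<otimes> inv y) X) = shift (y' \<otimes> inv y) X"
      unfolding pmf.map_comp shift_def
    proof (rule pmf.map_cong[OF refl])
      fix x assume "x \<in> set_pmf X"
      then show "((\<lambda>z. z \<otimes> y') \<circ> (\<lambda>x. x \<otimes> inv y)) x = x \<otimes> (y' \<otimes> inv y)"
        using Xc yc by (auto simp: m_ac subset_iff)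
    qed
    finally show ?thesis by simp
  qed
  have sub: "S \<subseteq> set_pmf X" "T \<subseteq> set_pmf Y" by (auto simp: S_def T_def)
  have "measure_pmf.prob X S > 3/4" "measure_pmf.prob Y T > 3/4" using S T eta by linarith+
  then obtain H where H: "subgroup H G" "finite H" "\<forall>h\<in>H. close_pmf X (shift h X) (2*d)"
      "\<forall>h\<in>H. close_pmf Y (shift h Y) (2*d)" "\<forall>x\<in>S. \<forall>x'\<in>S. x' \<otimes> inv x \<in> H"
      "\<forall>y\<in>T. \<forall>y'\<in>T. y' \<otimes> inv y \<in> H"
    using exists_almost_stabilizer[OF X Y sub(1) _ sub(2) _ SY TX] d by auto
  have "S \<noteq> {}" "T \<noteq> {}" using S T eta by auto
  \<comment> \<open>Any typical values represent the two cosets, since differences of typical values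
    lie in \<open>H\<close>.\<close>
  then obtain x\<^sub>0 y\<^sub>0 where x0: "x\<^sub>0 \<in> S" and y0: "y\<^sub>0 \<in> T" by auto
  have "measure_pmf.prob X S \<le> measure_pmf.prob X {x \<in> carrier G. x \<otimes> inv x\<^sub>0 \<in> H}"
    using x0 H(5) sub Xc by (intro measure_pmf.finite_measure_mono) auto
  moreover have "measure_pmf.prob Y T \<le> measure_pmf.prob Y {y \<in> carrier G. y \<otimes> inv y\<^sub>0 \<in> H}"
    using y0 H(6) sub Yc by (intro measure_pmf.finite_measure_mono) auto
  moreover have "x\<^sub>0 \<in> carrier G" "y\<^sub>0 \<in> carrier G" using x0 y0 sub Xc Yc by auto
  ultimately show ?thesis using H S T by (meson order_trans)
qed

end

subsection \<open>Averaging over a finite subgroup\<close>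

lemma sum_pmf_eq_expectation:
  assumes "finite (set_pmf X)"
  shows "(\<Sum>x\<in>set_pmf X. pmf X x * F x) = measure_pmf.expectation X F"
  using integral_measure_pmf_real[OF assms, of X F] by (auto simp: mult.commute)

text \<open>The event is read as the value \<open>True\<close> of its indicator, so that the formula
  for point masses applies.\<close>

lemma prob_bind_finite:
  assumes "finite (set_pmf Y)"
  shows "measure_pmf.prob (bind_pmf Y K) A = (\<Sum>y\<in>set_pmf Y. pmf Y y * measure_pmf.prob (K y) A)"
proof -
  have pr: "measure_pmf.prob P A = pmf (map_pmf (\<lambda>x. x \<in> A) P) True" for P
    by (simp add: pmf_map vimage_def)
  show ?thesis unfolding pr map_bind_pmf by (rule pmf_bind_finite[OF assms])
qed

text \<open>Multiplied by the mass under \<open>Q\<close>, the linear term of \<open>psi\<close>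
  becomes the difference of the two masses, which sums to \<open>0\<close> over a set carrying both
  laws.\<close>

lemma kl_div_eq_psi:
  assumes fQ: "finite (set_pmf Q)" and PQ: "set_pmf P \<subseteq> set_pmf Q"
  shows "kl_div P Q = (\<Sum>x\<in>set_pmf Q. pmf Q x * psi ((pmf P x - pmf Q x) / pmf Q x))"
proof -
  have sP: "(\<Sum>x\<in>set_pmf Q. pmf P x) = 1" and sQ: "(\<Sum>x\<in>set_pmf Q. pmf Q x) = 1"
    using fQ PQ by (auto intro!: sum_pmf_eq_1)
  have "(\<Sum>x\<in>set_pmf Q. pmf Q x * psi ((pmf P x - pmf Q x) / pmf Q x))
    = (\<Sum>x\<in>set_pmf Q. pmf P x * ln (pmf P x / pmf Q x) - pmf P x + pmf Q x)"
  proof (rule sum.cong[OF refl])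
    fix x assume "x \<in> set_pmf Q"
    then have q: "pmf Q x > 0" by (simp add: pmf_positive)
    then have t: "(pmf P x - pmf Q x) / pmf Q x = pmf P x / pmf Q x - 1" by (simp add: field_simps)
    show "pmf Q x * psi ((pmf P x - pmf Q x) / pmf Q x) = pmf P x * ln (pmf P x / pmf Q x) - pmf P x + pmf Q x"
      unfolding psi_def t using q by (simp add: right_diff_distrib)
  qed
  also have "\<dots> = (\<Sum>x\<in>set_pmf Q. pmf P x * ln (pmf P x / pmf Q x))"
    by (simp add: sum.distrib sum_subtractf sP sQ)
  also have "\<dots> = kl_div P Q"
    unfolding kl_div_def using fQ PQ by (intro sum.mono_neutral_right) (auto simp: set_pmf_iff)
  finally show ?thesis by simp
qed

context abelian_group_law
begin

definition coset :: "'a set \<Rightarrow> 'a \<Rightarrow> 'a set" where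
  "coset H x = {y \<in> carrier G. y \<otimes> inv x \<in> H}"

definition right_invariant :: "'a set \<Rightarrow> ('a \<Rightarrow> 'b) \<Rightarrow> bool" where
  "right_invariant H F \<longleftrightarrow> (\<forall>x\<in>carrier G. \<forall>h\<in>H. F (x \<otimes> h) = F x)"

text \<open>Given \<open>Y = y\<close>, the difference is \<open>z\<close> exactly if
  \<open>X = z + y\<close>. The index set \<open>T\<close> may exceed the support of
  \<open>Y\<close>, so that several such sums can share one range.\<close>

lemma pmf_diff_right:
  assumes X: "group_valued G X" and Y: "group_valued G Y" and T: "finite T" "set_pmf Y \<subseteq> T" "T \<subseteq> carrier G"
    and z: "z \<in> carrier G"
  shows "pmf (diff_pmf G X Y) z = (\<Sum>y\<in>T. pmf Y y * pmf X (z \<otimes> y))"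
proof -
  have "pmf (diff_pmf G X Y) z = (\<Sum>y\<in>set_pmf Y. pmf Y y * pmf (map_pmf (\<lambda>x. x \<otimes> inv y) X) z)"
    unfolding diff_pmf_eq_bind_right using Y by (intro pmf_bind_finite) (auto simp: group_valued_def)
  also have "\<dots> = (\<Sum>y\<in>set_pmf Y. pmf Y y * pmf X (z \<otimes> y))"
  proof (intro sum.cong refl arg_cong2[where f = "(*)"])
    fix y assume "y \<in> set_pmf Y"
    then have y: "y \<in> carrier G" using Y by (auto simp: group_valued_def)
    have "pmf (map_pmf (\<lambda>x. x \<otimes> inv y) X) z = measure_pmf.prob X ((\<lambda>x. x \<otimes> inv y) -` {z})"
      by (rule pmf_map)
    also have "\<dots> = measure_pmf.prob X {z \<otimes> y}"
      using X y z by (intro measure_eq_AE) (auto simp: AE_measure_pmf_iff group_valued_def m_assoc subset_iff)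
    finally show "pmf (map_pmf (\<lambda>x. x \<otimes> inv y) X) z = pmf X (z \<otimes> y)"
      by (simp add: measure_pmf_single)
  qed
  also have "\<dots> = (\<Sum>y\<in>T. pmf Y y * pmf X (z \<otimes> y))"
    using T by (intro sum.mono_neutral_left) (auto simp: set_pmf_iff)
  finally show ?thesis .
qed

lemma pmf_diff_left:
  assumes X: "group_valued G X" and Y: "group_valued G Y" and z: "z \<in> carrier G"
  shows "pmf (diff_pmf G X Y) z = (\<Sum>x\<in>set_pmf X. pmf X x * pmf Y (x \<otimes> inv z))"
proof -
  have "pmf (diff_pmf G X Y) z = (\<Sum>x\<in>set_pmf X. pmf X x * pmf (map_pmf (\<lambda>y. x \<otimes> inv y) Y) z)"
    unfolding diff_pmf_eq_bind_left using X by (intro pmf_bind_finite) (auto simp: group_valued_def)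
  also have "\<dots> = (\<Sum>x\<in>set_pmf X. pmf X x * pmf Y (x \<otimes> inv z))"
  proof (intro sum.cong refl arg_cong2[where f = "(*)"])
    fix x assume "x \<in> set_pmf X"
    then have x: "x \<in> carrier G" using X by (auto simp: group_valued_def)
    have "pmf (map_pmf (\<lambda>y. x \<otimes> inv y) Y) z = measure_pmf.prob Y ((\<lambda>y. x \<otimes> inv y) -` {z})"
      by (rule pmf_map)
    also have "\<dots> = measure_pmf.prob Y {x \<otimes> inv z}"
    proof (intro measure_eq_AE)
      have "x \<otimes> inv y = z \<longleftrightarrow> y = x \<otimes> inv z" if "y \<in> carrier G" for y
        using that x z by (metis inv_closed inv_solve_right m_comm)
      then show "AE y in measure_pmf Y. y \<in> (\<lambda>y. x \<otimes> inv y) -` {z} \<longleftrightarrow> y \<in> {x \<otimes> inv z}"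
        using Y by (auto simp: AE_measure_pmf_iff group_valued_def subset_iff)
    qed auto
    finally show "pmf (map_pmf (\<lambda>y. x \<otimes> inv y) Y) z = pmf Y (x \<otimes> inv z)"
      by (simp add: measure_pmf_single)
  qed
  finally show ?thesis .
qed

end

locale finite_subgroup_law = abelian_group_law +
  fixes H :: "'a set"
  assumes subgroup: "subgroup H G" and finite_H: "finite H"
begin

lemma H_carrier: "h \<in> H \<Longrightarrow> h \<in> carrier G" and one_H: "\<one> \<in> H"
  and inv_H: "h \<in> H \<Longrightarrow> inv h \<in> H" and mult_H: "h \<in> H \<Longrightarrow> k \<in> H \<Longrightarrow> h \<otimes> k \<in> H"
  using subgroup by (auto dest: subgroup.mem_carrier subgroup.one_closed subgroup.m_inv_closed subgroup.m_closed)

lemma H_nonempty: "H \<noteq> {}" using one_H by auto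

lemma card_H: "card H > 0" using finite_H H_nonempty by (simp add: card_gt_0_iff)

lemma group_valued_uniform: "group_valued G (pmf_of_set H)"
  using finite_H H_nonempty H_carrier by (auto simp: group_valued_def)

lemma entropy_uniform: "shannon_entropy (pmf_of_set H) = ln (card H)"
  using finite_H H_nonempty card_H by (simp add: shannon_entropy_def)

text \<open>The law of \<open>X - U\<^sub>H\<close>, that is, the average of \<open>X\<close> over
  translates by \<open>H\<close>. It is constant on each coset of \<open>H\<close> and keeps the
  masses of the cosets.\<close>

definition blur :: "'a pmf \<Rightarrow> 'a pmf" where
  "blur X = diff_pmf G X (pmf_of_set H)"

lemma group_valued_blur: "group_valued G X \<Longrightarrow> group_valued G (blur X)"
  unfolding blur_def using group_valued_diff group_valued_uniform by blast

lemma pmf_blur: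
  assumes "group_valued G X" "z \<in> carrier G"
  shows "pmf (blur X) z = (\<Sum>h\<in>H. pmf X (z \<otimes> h)) / card H"
  unfolding blur_def using assms finite_H H_nonempty H_carrier
  by (subst pmf_diff_right[of X "pmf_of_set H" H]) (auto simp: group_valued_uniform sum_divide_distrib)

lemma bij_mult_H: "k \<in> H \<Longrightarrow> bij_betw (\<lambda>h. k \<otimes> h) H H"
  by (rule bij_betw_byWitness[where f' = "\<lambda>h. inv k \<otimes> h"])
    (auto simp: mult_H inv_H H_carrier m_assoc[symmetric])

lemma blur_invariant:
  assumes X: "group_valued G X"
  shows "right_invariant H (pmf (blur X))"
  unfolding right_invariant_def
proof (intro ballI)
  fix z k assume zk: "z \<in> carrier G" "k \<in> H"
  have "(\<Sum>h\<in>H. pmf X (z \<otimes> k \<otimes> h)) = (\<Sum>h\<in>H. pmf X (z \<otimes> (k \<otimes> h)))"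
    using zk by (intro sum.cong) (auto simp: m_assoc H_carrier)
  also have "\<dots> = (\<Sum>h\<in>H. pmf X (z \<otimes> h))"
    by (rule sum.reindex_bij_betw[OF bij_mult_H[OF zk(2)]])
  finally show "pmf (blur X) (z \<otimes> k) = pmf (blur X) z"
    using zk X by (simp add: pmf_blur H_carrier)
qed

text \<open>An invariant \<open>F\<close> does not see the subtracted element of \<open>H\<close>,
  so \<open>F (X - U\<^sub>H)\<close> and \<open>F X\<close> are the same variable.\<close>

lemma sum_blur_invariant:
  assumes X: "group_valued G X" and F: "right_invariant H F"
  shows "(\<Sum>x\<in>set_pmf (blur X). pmf (blur X) x * F x) = (\<Sum>x\<in>set_pmf X. pmf X x * (F x :: real))"
proof -
  have "measure_pmf.expectation (blur X) F
      = measure_pmf.expectation (pair_pmf X (pmf_of_set H)) (\<lambda>(x, u). F (x \<otimes> inv u))"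
    unfolding blur_def diff_pmf_def by (simp add: case_prod_unfold)
  also have "\<dots> = measure_pmf.expectation (pair_pmf X (pmf_of_set H)) (\<lambda>p. F (fst p))"
  proof (rule integral_cong_AE)
    show "AE p in measure_pmf (pair_pmf X (pmf_of_set H)). (case p of (x, u) \<Rightarrow> F (x \<otimes> inv u)) = F (fst p)"
      using X F finite_H H_nonempty
      by (auto simp: AE_measure_pmf_iff right_invariant_def group_valued_def inv_H subset_iff)
  qed auto
  also have "\<dots> = measure_pmf.expectation (map_pmf fst (pair_pmf X (pmf_of_set H))) F" by simp
  also have "\<dots> = measure_pmf.expectation X F" by (simp only: map_fst_pair_pmf)
  finally show ?thesis
    using X group_valued_blur[OF X] by (simp add: sum_pmf_eq_expectation group_valued_def)
qed

lemma set_pmf_blur: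
  assumes X: "group_valued G X" shows "set_pmf X \<subseteq> set_pmf (blur X)"
proof
  fix x assume x: "x \<in> set_pmf X"
  then have xc: "x \<in> carrier G" using X by (auto simp: group_valued_def)
  have "0 < pmf X (x \<otimes> \<one>)" using x xc by (simp add: pmf_positive)
  also have "\<dots> \<le> (\<Sum>h\<in>H. pmf X (x \<otimes> h))"
    using finite_H one_H by (intro member_le_sum) auto
  finally show "x \<in> set_pmf (blur X)"
    using X xc card_H by (simp add: set_pmf_iff pmf_blur)
qed

lemma coset_eq: "z \<in> carrier G \<Longrightarrow> coset H z = (\<lambda>h. z \<otimes> h) ` H"
proof (intro equalityI subsetI)
  fix x assume z: "z \<in> carrier G" and "x \<in> coset H z"
  then have x: "x \<in> carrier G" "x \<otimes> inv z \<in> H" by (auto simp: coset_def)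
  then have "x = z \<otimes> (x \<otimes> inv z)" using z by (simp add: m_lcomm)
  then show "x \<in> (\<lambda>h. z \<otimes> h) ` H" using x by blast
next
  fix x assume z: "z \<in> carrier G" and "x \<in> (\<lambda>h. z \<otimes> h) ` H"
  then obtain h where "x = z \<otimes> h" "h \<in> H" by auto
  then show "x \<in> coset H z" using z H_carrier by (auto simp: coset_def m_comm[of z h] m_assoc)
qed

lemma finite_coset: "z \<in> carrier G \<Longrightarrow> finite (coset H z)"
  using finite_H by (simp add: coset_eq)

lemma card_coset: "z \<in> carrier G \<Longrightarrow> card (coset H z) = card H"
  using H_carrier by (auto simp: coset_eq card_image inj_on_def)

text \<open>From here on the mass of a coset is expressed as
  \<open>card H * pmf (blur X) z\<close>.\<close>

lemma prob_coset:
  assumes X: "group_valued G X" and z: "z \<in> carrier G"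
  shows "measure_pmf.prob X (coset H z) = card H * pmf (blur X) z"
proof -
  have inj: "inj_on (\<lambda>h. z \<otimes> h) H" using z H_carrier by (auto simp: inj_on_def)
  have "measure_pmf.prob X (coset H z) = (\<Sum>x\<in>(\<lambda>h. z \<otimes> h) ` H. pmf X x)"
    using finite_H z by (simp add: coset_eq measure_measure_pmf_finite)
  also have "\<dots> = card H * pmf (blur X) z"
    using inj X z card_H by (simp add: sum.reindex pmf_blur)
  finally show ?thesis .
qed

text \<open>The function \<open>ln (1 / pmf (blur X) x)\<close> is invariant, so its mean under
  \<open>blur X\<close>, the entropy, equals its mean under \<open>X\<close>, the cross
  entropy.\<close>

lemma kl_div_blur:
  assumes X: "group_valued G X"
  shows "kl_div X (blur X) = shannon_entropy (blur X) - shannon_entropy X"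
proof -
  have inv: "right_invariant H (\<lambda>x. ln (1 / pmf (blur X) x))"
    using blur_invariant[OF X] by (simp add: right_invariant_def)
  have "shannon_entropy (blur X) = (\<Sum>x\<in>set_pmf X. pmf X x * ln (1 / pmf (blur X) x))"
    unfolding shannon_entropy_def by (rule sum_blur_invariant[OF X inv])
  then have "shannon_entropy (blur X) - shannon_entropy X
     = (\<Sum>x\<in>set_pmf X. pmf X x * ln (1 / pmf (blur X) x) - pmf X x * ln (1 / pmf X x))"
    by (simp add: shannon_entropy_def sum_subtractf)
  also have "\<dots> = kl_div X (blur X)"
    unfolding kl_div_def
  proof (rule sum.cong[OF refl])
    fix x assume x: "x \<in> set_pmf X"
    then have "pmf X x > 0" "pmf (blur X) x > 0" using set_pmf_blur[OF X] by (auto simp: pmf_positive)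
    then show "pmf X x * ln (1 / pmf (blur X) x) - pmf X x * ln (1 / pmf X x) = pmf X x * ln (pmf X x / pmf (blur X) x)"
      by (simp add: ln_div algebra_simps)
  qed
  finally show ?thesis by simp
qed

text \<open>The average is a uniform mixture of translates of \<open>X\<close> by elements of
  \<open>H\<close>, each within \<open>d\<close> of \<open>X\<close>.\<close>

lemma close_pmf_blur:
  assumes X: "group_valued G X" and c: "\<And>h. h \<in> H \<Longrightarrow> close_pmf X (shift h X) d"
  shows "close_pmf X (blur X) d"
  unfolding close_pmf_def
proof
  fix A
  let ?pA = "measure_pmf.prob X A"
  have "measure_pmf.prob (blur X) A = (\<Sum>u\<in>H. measure_pmf.prob (shift (inv u) X) A / card H)"
    unfolding blur_def diff_pmf_eq_bind_right shift_def
    using finite_H H_nonempty by (subst prob_bind_finite) auto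
  moreover have "?pA = (\<Sum>u\<in>H. ?pA / card H)" using card_H by simp
  ultimately have "?pA - measure_pmf.prob (blur X) A
      = (\<Sum>u\<in>H. ?pA / card H) - (\<Sum>u\<in>H. measure_pmf.prob (shift (inv u) X) A / card H)"
    by linarith
  also have "\<dots> = (\<Sum>u\<in>H. (?pA - measure_pmf.prob (shift (inv u) X) A) / card H)"
    by (simp only: sum_subtractf[symmetric] diff_divide_distrib)
  also have "\<bar>\<dots>\<bar> \<le> (\<Sum>u\<in>H. d / card H)"
  proof (rule order_trans[OF sum_abs], rule sum_mono)
    fix u assume "u \<in> H"
    then have "\<bar>?pA - measure_pmf.prob (shift (inv u) X) A\<bar> \<le> d"
      using c inv_H by (auto simp: close_pmf_def)
    then show "\<bar>(?pA - measure_pmf.prob (shift (inv u) X) A) / card H\<bar> \<le> d / card H"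
      by (simp add: divide_right_mono)
  qed
  also have "\<dots> = d" using card_H by simp
  finally show "\<bar>?pA - measure_pmf.prob (blur X) A\<bar> \<le> d" .
qed

lemma ruzsa_dist_uniform:
  assumes "group_valued G X"
  shows "ruzsa_dist G X (pmf_of_set H)
    = (shannon_entropy (blur X) - ln (card H)) / 2 + kl_div X (blur X) / 2"
  unfolding ruzsa_dist_def kl_div_blur[OF assms] entropy_uniform blur_def[symmetric] by (simp add: field_simps)

end

subsection \<open>The linear bound\<close>

context abelian_group_law
begin

lemma pmf_eq_on_carrier:
  assumes "group_valued G X" "group_valued G Y" "\<And>z. z \<in> carrier G \<Longrightarrow> pmf X z = pmf Y z"
  shows "X = Y"
proof (rule pmf_eqI)
  fix z show "pmf X z = pmf Y z"
  proof (cases "z \<in> carrier G")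
    case False
    then have "z \<notin> set_pmf X" "z \<notin> set_pmf Y" using assms by (auto simp: group_valued_def)
    then show ?thesis by (simp add: set_pmf_iff)
  qed (use assms in auto)
qed

end

context finite_subgroup_law
begin

section \<open>Cosets and averages of differences\<close>

lemma invariant_on_coset: "right_invariant H F \<Longrightarrow> z \<in> carrier G \<Longrightarrow> x \<in> coset H z \<Longrightarrow> F x = F z"
  by (auto simp: coset_eq right_invariant_def)

lemma coset_meet:
  assumes "a \<in> carrier G" "b \<in> carrier G" "x \<in> coset H a" "x \<in> coset H b"
  shows "a \<in> coset H b"
proof -
  have x: "x \<in> carrier G" "x \<otimes> inv a \<in> H" "x \<otimes> inv b \<in> H" using assms by (auto simp: coset_def)
  have "inv (x \<otimes> inv a) \<otimes> (x \<otimes> inv b) \<in> H" using x by (simp add: mult_H inv_H)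
  also have "inv (x \<otimes> inv a) \<otimes> (x \<otimes> inv b) = a \<otimes> inv b"
    using assms x by (simp add: inv_mult_group m_assoc) (simp add: m_assoc[symmetric])
  finally show ?thesis using assms by (simp add: coset_def)
qed

text \<open>Distinct cosets are disjoint. Thus once one coset has mass at least
  \<open>1 - \<eta>\<close>, every other has mass at most \<open>\<eta>\<close>.\<close>

lemma prob_two_cosets:
  assumes "group_valued G X" "a \<in> carrier G" "b \<in> carrier G" "a \<notin> coset H b"
  shows "card H * pmf (blur X) a + card H * pmf (blur X) b \<le> 1"
proof -
  have "coset H a \<inter> coset H b = {}" using coset_meet assms by blast
  then have "measure_pmf.prob X (coset H a) + measure_pmf.prob X (coset H b) \<le> 1"
    by (subst measure_pmf.finite_measure_Union[symmetric]) auto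
  then show ?thesis using assms by (simp add: prob_coset)
qed

lemma card_mult_blur_le_1: "group_valued G X \<Longrightarrow> z \<in> carrier G \<Longrightarrow> card H * pmf (blur X) z \<le> 1"
  using prob_coset[of X z] by (metis measure_pmf.prob_le_1)

text \<open>The mass of \<open>blur X\<close> at \<open>z + y\<close> is invariant in
  \<open>y\<close>, so replacing \<open>Y\<close> by its average does not change the
  convolution.\<close>

lemma diff_blur_right:
  assumes X: "group_valued G X" and Y: "group_valued G Y"
  shows "diff_pmf G (blur X) Y = diff_pmf G (blur X) (blur Y)"
proof (rule pmf_eq_on_carrier)
  have bX: "group_valued G (blur X)" and bY: "group_valued G (blur Y)"
    using X Y group_valued_blur by auto
  then show "group_valued G (diff_pmf G (blur X) Y)" "group_valued G (diff_pmf G (blur X) (blur Y))"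
    using Y group_valued_diff by auto
  fix z assume z: "z \<in> carrier G"
  have inv: "right_invariant H (\<lambda>y. pmf (blur X) (z \<otimes> y))"
    using blur_invariant[OF X] z H_carrier by (auto simp: right_invariant_def m_assoc[symmetric])
  have "pmf (diff_pmf G (blur X) Y) z = (\<Sum>y\<in>set_pmf Y. pmf Y y * pmf (blur X) (z \<otimes> y))"
    using bX Y z by (intro pmf_diff_right) (auto simp: group_valued_def)
  also have "\<dots> = (\<Sum>y\<in>set_pmf (blur Y). pmf (blur Y) y * pmf (blur X) (z \<otimes> y))"
    by (rule sum_blur_invariant[OF Y inv, symmetric])
  also have "\<dots> = pmf (diff_pmf G (blur X) (blur Y)) z"
    using bX bY z by (intro pmf_diff_right[symmetric]) (auto simp: group_valued_def)
  finally show "pmf (diff_pmf G (blur X) Y) z = pmf (diff_pmf G (blur X) (blur Y)) z" .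
qed

lemma diff_blur_left:
  assumes X: "group_valued G X" and Y: "group_valued G Y"
  shows "diff_pmf G X (blur Y) = diff_pmf G (blur X) (blur Y)"
proof (rule pmf_eq_on_carrier)
  have bX: "group_valued G (blur X)" and bY: "group_valued G (blur Y)"
    using X Y group_valued_blur by auto
  then show "group_valued G (diff_pmf G X (blur Y))" "group_valued G (diff_pmf G (blur X) (blur Y))"
    using X group_valued_diff by auto
  fix z assume z: "z \<in> carrier G"
  have inv: "right_invariant H (\<lambda>x. pmf (blur Y) (x \<otimes> inv z))"
    unfolding right_invariant_def
  proof (intro ballI)
    fix x h assume xh: "x \<in> carrier G" "h \<in> H"
    then have "x \<otimes> h \<otimes> inv z = x \<otimes> inv z \<otimes> h" using z H_carrier by (simp add: m_ac)
    then show "pmf (blur Y) (x \<otimes> h \<otimes> inv z) = pmf (blur Y) (x \<otimes> inv z)"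
      using blur_invariant[OF Y] xh z by (simp add: right_invariant_def)
  qed
  show "pmf (diff_pmf G X (blur Y)) z = pmf (diff_pmf G (blur X) (blur Y)) z"
    unfolding pmf_diff_left[OF X bY z] pmf_diff_left[OF bX bY z]
    by (rule sum_blur_invariant[OF X inv, symmetric])
qed

text \<open>Exchanging the sums over \<open>H\<close> and over \<open>Y\<close> moves the average
  onto \<open>X\<close>; it may then be put on \<open>Y\<close> as well.\<close>

lemma blur_diff:
  assumes X: "group_valued G X" and Y: "group_valued G Y"
  shows "blur (diff_pmf G X Y) = diff_pmf G (blur X) (blur Y)"
proof (rule pmf_eq_on_carrier)
  have bX: "group_valued G (blur X)" and bY: "group_valued G (blur Y)" and D: "group_valued G (diff_pmf G X Y)"
    using X Y group_valued_blur group_valued_diff by auto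
  then show "group_valued G (blur (diff_pmf G X Y))" "group_valued G (diff_pmf G (blur X) (blur Y))"
    using group_valued_diff group_valued_blur by auto
  have Yc: "finite (set_pmf Y)" "set_pmf Y \<subseteq> carrier G" using Y by (auto simp: group_valued_def)
  fix z assume z: "z \<in> carrier G"
  have "pmf (blur (diff_pmf G X Y)) z = (\<Sum>h\<in>H. \<Sum>y\<in>set_pmf Y. pmf Y y * pmf X (z \<otimes> h \<otimes> y)) / card H"
    unfolding pmf_blur[OF D z] using X Y Yc z H_carrier
    by (intro arg_cong2[where f = "(/)"] refl sum.cong pmf_diff_right) auto
  also have "\<dots> = (\<Sum>y\<in>set_pmf Y. pmf Y y * pmf (blur X) (z \<otimes> y))"
  proof -
    have "(\<Sum>h\<in>H. \<Sum>y\<in>set_pmf Y. pmf Y y * pmf X (z \<otimes> h \<otimes> y))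
      = (\<Sum>y\<in>set_pmf Y. pmf Y y * (\<Sum>h\<in>H. pmf X (z \<otimes> h \<otimes> y)))"
      by (subst sum.swap) (simp add: sum_distrib_left)
    also have "\<dots> = (\<Sum>y\<in>set_pmf Y. pmf Y y * (\<Sum>h\<in>H. pmf X (z \<otimes> y \<otimes> h)))"
      using Yc z H_carrier by (intro sum.cong refl arg_cong2[where f = "(*)"] arg_cong[where f = "pmf X"])
        (auto simp: m_ac subset_iff)
    also have "\<dots> / card H = (\<Sum>y\<in>set_pmf Y. pmf Y y * pmf (blur X) (z \<otimes> y))"
      unfolding sum_divide_distrib using Yc z X by (intro sum.cong refl) (auto simp: pmf_blur subset_iff)
    finally show ?thesis .
  qed
  also have "\<dots> = pmf (diff_pmf G (blur X) Y) z"
    using bX Y Yc z by (intro pmf_diff_right[symmetric]) auto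
  finally show "pmf (blur (diff_pmf G X Y)) z = pmf (diff_pmf G (blur X) (blur Y)) z"
    by (simp add: diff_blur_right[OF X Y])
qed

text \<open>With \<open>p, q\<close> the laws of \<open>X, Y\<close>, primes for their averages over \<open>H\<close>, and \<open>r\<close> the law of \<open>X - Y\<close>, one has
  \<open>r - r' = (p - p') * (q - q')\<close> (difference convolution). The two factors have no sign, so \<open>psi\<close> is replaced by
  the comparable even function \<open>psi \<bar>t\<bar>\<close>, to which Jensen applies with weights
  \<open>\<bar>q - q'\<bar>(y) p'(z + y) / (2 r'(z))\<close>; these sum to at most \<open>1\<close> because \<open>\<bar>q - q'\<bar> \<le> q + q'\<close>.\<close>

lemma kl_div_diff_le:
  assumes X: "group_valued G X" and Y: "group_valued G Y"
  defines "L \<equiv> \<Sum>y\<in>set_pmf (blur Y). \<bar>pmf Y y - pmf (blur Y) y\<bar>"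
  shows "kl_div (diff_pmf G X Y) (blur (diff_pmf G X Y)) \<le> 16 * L * kl_div X (blur X)"
proof -
  let ?R = "diff_pmf G X Y" and ?T = "set_pmf (blur Y)"
  let ?p = "pmf X" and ?q = "pmf Y" and ?r = "pmf ?R"
    and ?p' = "pmf (blur X)" and ?q' = "pmf (blur Y)" and ?r' = "pmf (blur ?R)"
  let ?g = "\<lambda>y. ?q y - ?q' y" and ?f = "\<lambda>x. ?p x - ?p' x"
  \<comment> \<open>The factor \<open>2\<close> cancels the one in the denominator of the weights;
    \<open>psi_double\<close> disposes of it in the end.\<close>
  let ?t = "\<lambda>x. 2 * (\<bar>?f x\<bar> / ?p' x)"
  have gv: "group_valued G (blur X)" "group_valued G (blur Y)" "group_valued G ?R" "group_valued G (blur ?R)"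
    using X Y group_valued_blur group_valued_diff by auto
  have T: "finite ?T" "?T \<subseteq> carrier G" "set_pmf Y \<subseteq> ?T"
    using gv set_pmf_blur[OF Y] by (auto simp: group_valued_def)
  have fX: "finite (set_pmf (blur X))" "set_pmf X \<subseteq> set_pmf (blur X)" "set_pmf (blur X) \<subseteq> carrier G"
    using gv set_pmf_blur[OF X] by (auto simp: group_valued_def)
  have fR: "finite (set_pmf (blur ?R))" "set_pmf ?R \<subseteq> set_pmf (blur ?R)" "set_pmf (blur ?R) \<subseteq> carrier G"
    using gv set_pmf_blur[of ?R] by (auto simp: group_valued_def)
  have t0: "0 \<le> ?t x" for x by simp
  \<comment> \<open>Where \<open>?p'\<close> vanishes so does \<open>?p\<close>, hence the division
    can be undone everywhere.\<close>
  have f0: "\<bar>?f x\<bar> = ?p' x * (\<bar>?f x\<bar> / ?p' x)" for x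
  proof (cases "?p' x = 0")
    case True
    then have "?p x = 0" using fX by (auto simp: set_pmf_iff subset_iff)
    then show ?thesis using True by simp
  qed simp
  have point: "?r' z * psi ((?r z - ?r' z) / ?r' z)
      \<le> 2 * (\<Sum>y\<in>?T. \<bar>?g y\<bar> * (?p' (z \<otimes> y) * psi (?t (z \<otimes> y))))"
    if z: "z \<in> set_pmf (blur ?R)" for z
  proof -
    have zc: "z \<in> carrier G" using z fR by auto
    have r'0: "?r' z > 0" using z by (simp add: pmf_positive)
    \<comment> \<open>Averaging \<open>X\<close>, \<open>Y\<close> or both yields the same
      \<open>?r'\<close>. With these three expressions for \<open>?r'\<close>, expanding the product
      of \<open>?g\<close> and \<open>?f\<close> leaves exactly \<open>?r - ?r'\<close>.\<close>
    have e1: "?r z = (\<Sum>y\<in>?T. ?q y * ?p (z \<otimes> y))"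
      using X Y T zc by (intro pmf_diff_right) auto
    have e2: "?r' z = (\<Sum>y\<in>?T. ?q y * ?p' (z \<otimes> y))"
      unfolding blur_diff[OF X Y] diff_blur_right[OF X Y, symmetric]
      using gv Y T zc by (intro pmf_diff_right) auto
    have e3: "?r' z = (\<Sum>y\<in>?T. ?q' y * ?p (z \<otimes> y))"
      unfolding blur_diff[OF X Y] diff_blur_left[OF X Y, symmetric]
      using gv X T zc by (intro pmf_diff_right) auto
    have e4: "?r' z = (\<Sum>y\<in>?T. ?q' y * ?p' (z \<otimes> y))"
      unfolding blur_diff[OF X Y] using gv T zc by (intro pmf_diff_right) auto
    have "(\<Sum>y\<in>?T. ?g y * ?f (z \<otimes> y))
        = (\<Sum>y\<in>?T. ?q y * ?p (z \<otimes> y)) - (\<Sum>y\<in>?T. ?q y * ?p' (z \<otimes> y))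
          - (\<Sum>y\<in>?T. ?q' y * ?p (z \<otimes> y)) + (\<Sum>y\<in>?T. ?q' y * ?p' (z \<otimes> y))"
      by (simp add: sum.distrib[symmetric] sum_subtractf[symmetric] algebra_simps)
    then have gf: "?r z - ?r' z = (\<Sum>y\<in>?T. ?g y * ?f (z \<otimes> y))"
      using e1 e2 e3 e4 by linarith
    let ?w = "\<lambda>y. \<bar>?g y\<bar> * ?p' (z \<otimes> y) / (2 * ?r' z)"
    have "(\<Sum>y\<in>?T. \<bar>?g y\<bar> * ?p' (z \<otimes> y)) \<le> (\<Sum>y\<in>?T. ?q y * ?p' (z \<otimes> y) + ?q' y * ?p' (z \<otimes> y))"
    proof (rule sum_mono)
      fix y
      have "\<bar>?g y\<bar> \<le> ?q y + ?q' y" using pmf_nonneg[of Y y] pmf_nonneg[of "blur Y" y] by linarith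
      then show "\<bar>?g y\<bar> * ?p' (z \<otimes> y) \<le> ?q y * ?p' (z \<otimes> y) + ?q' y * ?p' (z \<otimes> y)"
        by (metis distrib_right mult_right_mono pmf_nonneg)
    qed
    also have "\<dots> = 2 * ?r' z" unfolding sum.distrib using e2 e4 by linarith
    finally have w1: "(\<Sum>y\<in>?T. ?w y) \<le> 1"
      using r'0 by (simp add: sum_divide_distrib[symmetric])
    have "\<bar>(?r z - ?r' z) / ?r' z\<bar> \<le> (\<Sum>y\<in>?T. \<bar>?g y * ?f (z \<otimes> y)\<bar>) / ?r' z"
      unfolding gf using r'0 by (simp add: divide_right_mono sum_abs)
    also have "\<dots> = (\<Sum>y\<in>?T. ?w y * ?t (z \<otimes> y))"
      unfolding sum_divide_distrib
    proof (intro sum.cong refl)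
      fix y
      define u where "u = \<bar>?f (z \<otimes> y)\<bar> / ?p' (z \<otimes> y)"
      have fu: "\<bar>?f (z \<otimes> y)\<bar> = ?p' (z \<otimes> y) * u" unfolding u_def by (rule f0)
      show "\<bar>?g y * ?f (z \<otimes> y)\<bar> / ?r' z = ?w y * ?t (z \<otimes> y)"
        unfolding abs_mult u_def[symmetric] unfolding fu by simp
    qed
    finally have a: "\<bar>(?r z - ?r' z) / ?r' z\<bar> \<le> (\<Sum>y\<in>?T. ?w y * ?t (z \<otimes> y))" .
    have "psi ((?r z - ?r' z) / ?r' z) \<le> 4 * psi \<bar>(?r z - ?r' z) / ?r' z\<bar>"
      using r'0 pmf_nonneg[of ?R z] by (intro psi_le_psi_abs) (simp add: field_simps)
    also have "\<dots> \<le> 4 * psi (\<Sum>y\<in>?T. ?w y * ?t (z \<otimes> y))"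
      using psi_mono[OF _ a] by simp
    also have "\<dots> \<le> 4 * (\<Sum>y\<in>?T. ?w y * psi (?t (z \<otimes> y)))"
      using T w1 r'0 t0 by (intro mult_left_mono psi_weighted_sum) auto
    finally have "?r' z * psi ((?r z - ?r' z) / ?r' z) \<le> ?r' z * (4 * (\<Sum>y\<in>?T. ?w y * psi (?t (z \<otimes> y))))"
      using r'0 by (intro mult_left_mono) auto
    also have "\<dots> = (\<Sum>y\<in>?T. 2 * (\<bar>?g y\<bar> * (?p' (z \<otimes> y) * psi (?t (z \<otimes> y)))))"
      unfolding sum_distrib_left using r'0 by (intro sum.cong refl) simp
    also have "\<dots> = 2 * (\<Sum>y\<in>?T. \<bar>?g y\<bar> * (?p' (z \<otimes> y) * psi (?t (z \<otimes> y))))"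
      by (simp only: sum_distrib_left)
    finally show ?thesis .
  qed
  have inner: "(\<Sum>z\<in>set_pmf (blur ?R). ?p' (z \<otimes> y) * psi (?t (z \<otimes> y))) \<le> 8 * kl_div X (blur X)"
    if y: "y \<in> ?T" for y
  proof -
    have yc: "y \<in> carrier G" using y T by auto
    have inj: "inj_on (\<lambda>z. z \<otimes> y) (set_pmf (blur ?R))" using fR yc by (auto simp: inj_on_def subset_iff)
    have "(\<Sum>z\<in>set_pmf (blur ?R). ?p' (z \<otimes> y) * psi (?t (z \<otimes> y)))
        = (\<Sum>x\<in>(\<lambda>z. z \<otimes> y) ` set_pmf (blur ?R). ?p' x * psi (?t x))"
      using sum.reindex[OF inj, of "\<lambda>x. ?p' x * psi (?t x)"] by simp
    \<comment> \<open>The added terms are nonnegative, and those off the support of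
      \<open>blur X\<close> vanish.\<close>
    also have "\<dots> \<le> (\<Sum>x\<in>(\<lambda>z. z \<otimes> y) ` set_pmf (blur ?R) \<union> set_pmf (blur X). ?p' x * psi (?t x))"
      using fR fX t0 by (intro sum_mono2) (auto intro!: mult_nonneg_nonneg psi_nonneg)
    also have "\<dots> = (\<Sum>x\<in>set_pmf (blur X). ?p' x * psi (?t x))"
      using fR fX by (intro sum.mono_neutral_right) (auto simp: set_pmf_iff)
    also have "\<dots> \<le> (\<Sum>x\<in>set_pmf (blur X). 8 * (?p' x * psi (?f x / ?p' x)))"
    proof (rule sum_mono)
      fix x assume "x \<in> set_pmf (blur X)"
      then have p': "?p' x > 0" by (simp add: pmf_positive)
      have "psi (?t x) \<le> 4 * psi (\<bar>?f x\<bar> / ?p' x)" using p' by (intro psi_double) auto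
      also have "\<bar>?f x\<bar> / ?p' x = \<bar>?f x / ?p' x\<bar>" using p' by simp
      also have "psi \<bar>?f x / ?p' x\<bar> \<le> 2 * psi (?f x / ?p' x)"
        using p' pmf_nonneg[of X x] by (intro psi_abs_le_psi) (simp add: field_simps)
      finally have "psi (?t x) \<le> 8 * psi (?f x / ?p' x)" by simp
      then have "?p' x * psi (?t x) \<le> ?p' x * (8 * psi (?f x / ?p' x))" using p' by (intro mult_left_mono) auto
      then show "?p' x * psi (?t x) \<le> 8 * (?p' x * psi (?f x / ?p' x))" by simp
    qed
    also have "\<dots> = 8 * kl_div X (blur X)"
      using kl_div_eq_psi[OF fX(1,2)] by (simp add: sum_distrib_left)
    finally show ?thesis .
  qed
  have "kl_div ?R (blur ?R) = (\<Sum>z\<in>set_pmf (blur ?R). ?r' z * psi ((?r z - ?r' z) / ?r' z))"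
    by (rule kl_div_eq_psi[OF fR(1,2)])
  also have "\<dots> \<le> (\<Sum>z\<in>set_pmf (blur ?R). 2 * (\<Sum>y\<in>?T. \<bar>?g y\<bar> * (?p' (z \<otimes> y) * psi (?t (z \<otimes> y)))))"
    by (rule sum_mono[OF point])
  \<comment> \<open>After the exchange the inner sum is bounded by the divergence of
    \<open>X\<close> uniformly in \<open>y\<close>, so the outer weights sum to
    \<open>L\<close>.\<close>
  also have "\<dots> = 2 * (\<Sum>y\<in>?T. \<bar>?g y\<bar> * (\<Sum>z\<in>set_pmf (blur ?R). ?p' (z \<otimes> y) * psi (?t (z \<otimes> y))))"
    unfolding sum_distrib_left[symmetric] by (subst sum.swap) (simp only: sum_distrib_left)
  also have "\<dots> \<le> 2 * (\<Sum>y\<in>?T. \<bar>?g y\<bar> * (8 * kl_div X (blur X)))"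
    by (intro mult_left_mono sum_mono inner) auto
  also have "\<dots> = 16 * L * kl_div X (blur X)"
    unfolding L_def sum_distrib_right[symmetric] by simp
  finally show ?thesis .
qed

section \<open>Entropy modulo the subgroup\<close>

lemma entropy_blur_excess:
  assumes X: "group_valued G X"
  shows "card H * (shannon_entropy (blur X) - ln (card H)) = (\<Sum>x\<in>set_pmf (blur X). ent (card H * pmf (blur X) x))"
proof -
  have fin: "finite (set_pmf (blur X))" using group_valued_blur[OF X] by (simp add: group_valued_def)
  have "shannon_entropy (blur X) - ln (card H)
     = (\<Sum>x\<in>set_pmf (blur X). pmf (blur X) x * ln (1 / pmf (blur X) x) - pmf (blur X) x * ln (card H))"
    unfolding shannon_entropy_def sum_subtractf sum_distrib_right[symmetric]
    using sum_pmf_eq_1[OF fin] by simp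
  \<comment> \<open>The final sum runs over group elements, so every coset occurs
    \<open>card H\<close> times; this explains the factor on the left.\<close>
  then have "card H * (shannon_entropy (blur X) - ln (card H)) = card H * (\<Sum>x\<in>set_pmf (blur X).
      pmf (blur X) x * ln (1 / pmf (blur X) x) - pmf (blur X) x * ln (card H))" by simp
  also have "\<dots> = (\<Sum>x\<in>set_pmf (blur X). ent (card H * pmf (blur X) x))"
    unfolding sum_distrib_left
  proof (rule sum.cong[OF refl])
    fix x assume "x \<in> set_pmf (blur X)"
    then have "pmf (blur X) x > 0" by (simp add: pmf_positive)
    then show "card H * (pmf (blur X) x * ln (1 / pmf (blur X) x) - pmf (blur X) x * ln (card H)) = ent (card H * pmf (blur X) x)"
      using card_H by (simp add: ent_def ln_div ln_mult algebra_simps)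
  qed
  finally show ?thesis .
qed

lemma ent_blur_nonneg: "group_valued G X \<Longrightarrow> z \<in> carrier G \<Longrightarrow> 0 \<le> ent (card H * pmf (blur X) z)"
  by (intro ent_nonneg card_mult_blur_le_1) auto

lemma entropy_blur_ge:
  assumes X: "group_valued G X"
  shows "ln (card H) \<le> shannon_entropy (blur X)"
proof -
  have "0 \<le> (\<Sum>x\<in>set_pmf (blur X). ent (card H * pmf (blur X) x))"
    using X group_valued_blur[OF X] by (intro sum_nonneg ent_blur_nonneg) (auto simp: group_valued_def)
  then have "0 \<le> card H * (shannon_entropy (blur X) - ln (card H))"
    using entropy_blur_excess[OF X] by simp
  then show ?thesis using card_H by (simp add: zero_le_mult_iff)
qed

text \<open>On the main coset \<open>u ln (1/u) \<le> 1 - u\<close>, which is the mass of the tail; each coset in the tail has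
  mass at most \<open>\<eta>\<close>, so the tail mass is at most \<open>1 / ln (1/\<eta>)\<close> times the tail entropy.\<close>

lemma entropy_blur_excess_le_tail:
  assumes X: "group_valued G X" and x0: "x\<^sub>0 \<in> carrier G" and \<eta>: "\<eta> = (1/2)^20"
    and pr: "1 - \<eta> \<le> card H * pmf (blur X) x\<^sub>0"
  shows "card H * (shannon_entropy (blur X) - ln (card H))
    \<le> 43/40 * (\<Sum>x\<in>set_pmf (blur X) - coset H x\<^sub>0. ent (card H * pmf (blur X) x))"
proof -
  let ?S = "set_pmf (blur X)" and ?C = "coset H x\<^sub>0" and ?n = "real (card H)" and ?p = "pmf (blur X)"
  let ?tail = "\<Sum>x\<in>?S - ?C. ent (?n * ?p x)"
  have S: "finite ?S" "?S \<subseteq> carrier G" using group_valued_blur[OF X] by (auto simp: group_valued_def)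
  have e: "0 \<le> \<eta>" "\<eta> \<le> 1/10" unfolding \<eta> by (simp_all add: power_one_over)
  have inC: "?p x = ?p x\<^sub>0" if "x \<in> ?C" for x
    using invariant_on_coset[OF blur_invariant[OF X] x0 that] .
  have fC: "finite ?C" "card ?C = card H" using x0 by (auto simp: finite_coset card_coset)
  have cSC: "real (card (?S \<inter> ?C)) \<le> ?n" using card_mono[OF fC(1), of "?S \<inter> ?C"] fC(2) by simp
  have split: "(\<Sum>x\<in>?S. F x) = (\<Sum>x\<in>?S \<inter> ?C. F x) + (\<Sum>x\<in>?S - ?C. F x)" for F :: "'a \<Rightarrow> real"
    using S(1) by (rule sum.Int_Diff)
  have "(\<Sum>x\<in>?S \<inter> ?C. ?p x) = card (?S \<inter> ?C) * ?p x\<^sub>0" using inC by simp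
  also have "\<dots> \<le> ?n * ?p x\<^sub>0" using cSC by (intro mult_right_mono) auto
  finally have "1 - ?n * ?p x\<^sub>0 \<le> (\<Sum>x\<in>?S - ?C. ?p x)"
    using split[of ?p] sum_pmf_eq_1[OF S(1)] by simp
  then have main1: "?n * (1 - ?n * ?p x\<^sub>0) \<le> (\<Sum>x\<in>?S - ?C. ?n * ?p x)"
    unfolding sum_distrib_left[symmetric] by (intro mult_left_mono) auto
  have "(\<Sum>x\<in>?S \<inter> ?C. ent (?n * ?p x)) = card (?S \<inter> ?C) * ent (?n * ?p x\<^sub>0)" using inC by simp
  also have "\<dots> \<le> ?n * ent (?n * ?p x\<^sub>0)"
    using cSC ent_blur_nonneg[OF X x0] by (intro mult_right_mono) auto
  also have "\<dots> \<le> ?n * (1 - ?n * ?p x\<^sub>0)"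
    using pr e by (intro mult_left_mono ent_le) auto
  also note main1
  \<comment> \<open>Since \<open>ln 2 \<ge> 2/3\<close>, a mass of at most \<open>2^(-20)\<close> is
    at most \<open>3/40\<close> of its entropy term; with the tail itself this makes
    \<open>43/40\<close>.\<close>
  also have "(\<Sum>x\<in>?S - ?C. ?n * ?p x) \<le> (\<Sum>x\<in>?S - ?C. 3/40 * ent (?n * ?p x))"
  proof (rule sum_mono)
    fix x assume x: "x \<in> ?S - ?C"
    then have "?n * ?p x \<le> (1/2)^20"
      using prob_two_cosets[OF X _ x0, of x] S pr \<eta> by (auto simp: subset_iff)
    then have "20 * ln 2 * (?n * ?p x) \<le> ent (?n * ?p x)"
      using ent_ge[of "?n * ?p x" 20] by simp
    moreover have "20 * (2/3) * (?n * ?p x) \<le> 20 * ln 2 * (?n * ?p x)"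
      using ln2_ge_two_thirds by (intro mult_right_mono) auto
    ultimately show "?n * ?p x \<le> 3/40 * ent (?n * ?p x)" by linarith
  qed
  also have "\<dots> = 3/40 * ?tail" by (simp add: sum_distrib_left)
  finally show ?thesis
    unfolding entropy_blur_excess[OF X] using split[of "\<lambda>x. ent (?n * ?p x)"] by simp
qed

text \<open>If \<open>Y\<close> is in the coset of \<open>b\<close> and \<open>X\<close> in that of
  \<open>z + b\<close>, then \<open>X - Y\<close> is in the coset of \<open>z\<close>; for different
  \<open>b\<close> in \<open>B\<close> these events are disjoint.\<close>

lemma blur_diff_ge_sum_cosets:
  assumes X: "group_valued G X" and Y: "group_valued G Y" and z: "z \<in> carrier G"
    and B: "finite B" "B \<subseteq> carrier G" "\<And>a b. a \<in> B \<Longrightarrow> b \<in> B \<Longrightarrow> a \<noteq> b \<Longrightarrow> a \<notin> coset H b"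
  shows "(\<Sum>b\<in>B. (card H * pmf (blur Y) b) * (card H * pmf (blur X) (z \<otimes> b)))
    \<le> card H * pmf (blur (diff_pmf G X Y)) z"
proof -
  let ?F = "\<lambda>y. pmf (blur Y) y * pmf (blur X) (z \<otimes> y)"
  let ?U = "\<Union>b\<in>B. coset H b"
  have gv: "group_valued G (blur X)" "group_valued G (blur Y)" using X Y group_valued_blur by auto
  have inv: "right_invariant H ?F"
    using blur_invariant[OF X] blur_invariant[OF Y] z H_carrier
    by (auto simp: right_invariant_def m_assoc[symmetric])
  have "finite ?U" using B by (intro finite_UN_I finite_coset) auto
  then have fU: "finite ?U" "?U \<subseteq> carrier G" by (auto simp: coset_def)
  have T: "finite (set_pmf (blur Y))" "set_pmf (blur Y) \<subseteq> carrier G" using gv by (auto simp: group_valued_def)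
  have "(\<Sum>b\<in>B. card H * ?F b) = (\<Sum>b\<in>B. \<Sum>y\<in>coset H b. ?F y)"
  proof (rule sum.cong[OF refl])
    fix b assume b: "b \<in> B"
    then have "(\<Sum>y\<in>coset H b. ?F y) = (\<Sum>y\<in>coset H b. ?F b)"
      using B by (intro sum.cong refl invariant_on_coset[OF inv]) auto
    then show "card H * ?F b = (\<Sum>y\<in>coset H b. ?F y)" using b B card_coset by auto
  qed
  also have "\<dots> = (\<Sum>y\<in>?U. ?F y)"
  proof (rule sum.UNION_disjoint[symmetric])
    show "\<forall>i\<in>B. \<forall>j\<in>B. i \<noteq> j \<longrightarrow> coset H i \<inter> coset H j = {}"
      using B coset_meet by blast
  qed (use B finite_coset in auto)
  also have "\<dots> \<le> (\<Sum>y\<in>set_pmf (blur Y) \<union> ?U. ?F y)"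
    using fU T by (intro sum_mono2) auto
  also have "\<dots> = pmf (blur (diff_pmf G X Y)) z"
    unfolding blur_diff[OF X Y] using gv z T fU by (intro pmf_diff_right[symmetric]) auto
  finally have "card H * (\<Sum>b\<in>B. card H * ?F b) \<le> card H * pmf (blur (diff_pmf G X Y)) z"
    by (intro mult_left_mono) auto
  then show ?thesis unfolding sum_distrib_left by (simp add: mult_ac)
qed

text \<open>A coset off the main one is reached with \<open>Y\<close> typical and \<open>X\<close>
  in its tail, or with \<open>X\<close> typical and \<open>Y\<close> in its tail. The two masses
  nearly add, and so do their entropy terms. Translation by \<open>y\<^sub>0\<close> and reflection
  in \<open>x\<^sub>0\<close> match these cosets with the tails of \<open>X\<close> and of
  \<open>Y\<close>.\<close>

lemma entropy_blur_diff_ge: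
  assumes X: "group_valued G X" and Y: "group_valued G Y"
    and x0: "x\<^sub>0 \<in> carrier G" and y0: "y\<^sub>0 \<in> carrier G" and \<eta>: "\<eta> = (1/2)^20"
    and pX: "1 - \<eta> \<le> card H * pmf (blur X) x\<^sub>0" and pY: "1 - \<eta> \<le> card H * pmf (blur Y) y\<^sub>0"
  shows "3/5 * ((shannon_entropy (blur X) - ln (card H)) + (shannon_entropy (blur Y) - ln (card H)))
    \<le> shannon_entropy (blur (diff_pmf G X Y)) - ln (card H)"
proof -
  let ?n = "real (card H)" and ?R = "diff_pmf G X Y"
  let ?P = "\<lambda>x. ?n * pmf (blur X) x" and ?Q = "\<lambda>y. ?n * pmf (blur Y) y" and ?r = "\<lambda>z. ?n * pmf (blur ?R) z"
  \<comment> \<open>A representative of the coset on which \<open>X - Y\<close> is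
    concentrated.\<close>
  define c where "c = x\<^sub>0 \<otimes> inv y\<^sub>0"
  define Z where "Z = set_pmf (blur ?R) - coset H c"
  have cc: "c \<in> carrier G" using x0 y0 by (simp add: c_def)
  have R: "group_valued G ?R" using X Y by (rule group_valued_diff)
  have e: "0 \<le> \<eta>" "\<eta> \<le> 1/10" unfolding \<eta> by (simp_all add: power_one_over)
  have set: "finite (set_pmf (blur W))" "set_pmf (blur W) \<subseteq> carrier G" if "group_valued G W" for W
    using group_valued_blur[OF that] by (auto simp: group_valued_def)
  have rc: "1 - 2 * \<eta> \<le> ?r c"
  proof -
    have "c \<otimes> y\<^sub>0 = x\<^sub>0" using x0 y0 by (simp add: c_def m_assoc)
    then have "?Q y\<^sub>0 * ?P x\<^sub>0 \<le> ?r c"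
      using blur_diff_ge_sum_cosets[OF X Y cc, of "{y\<^sub>0}"] y0 by simp
    moreover have "(1 - \<eta>) * (1 - \<eta>) \<le> ?Q y\<^sub>0 * ?P x\<^sub>0" using pX pY e by (intro mult_mono) auto
    moreover have "1 - 2 * \<eta> \<le> (1 - \<eta>) * (1 - \<eta>)" by (simp add: algebra_simps)
    ultimately show ?thesis by linarith
  qed
  have H_flip: "z \<otimes> y\<^sub>0 \<in> coset H x\<^sub>0 \<longleftrightarrow> z \<in> coset H c" "x\<^sub>0 \<otimes> inv z \<in> coset H y\<^sub>0 \<longleftrightarrow> z \<in> coset H c"
    if z: "z \<in> carrier G" for z
  proof -
    have eq: "z \<otimes> inv c = z \<otimes> y\<^sub>0 \<otimes> inv x\<^sub>0"
      using z x0 y0 by (simp add: c_def inv_mult_group m_ac)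
    then show "z \<otimes> y\<^sub>0 \<in> coset H x\<^sub>0 \<longleftrightarrow> z \<in> coset H c" using z x0 y0 by (simp add: coset_def)
    have "inv (z \<otimes> inv c) = x\<^sub>0 \<otimes> inv z \<otimes> inv y\<^sub>0"
      unfolding eq using z x0 y0 by (simp add: inv_mult_group m_ac)
    moreover have "inv (z \<otimes> inv c) \<in> H \<longleftrightarrow> z \<otimes> inv c \<in> H"
      using inv_H[of "z \<otimes> inv c"] inv_H[of "inv (z \<otimes> inv c)"] z cc by auto
    ultimately show "x\<^sub>0 \<otimes> inv z \<in> coset H y\<^sub>0 \<longleftrightarrow> z \<in> coset H c" using z x0 y0 by (simp add: coset_def)
  qed
  have point: "3/4 * (ent (?P (z \<otimes> y\<^sub>0)) + ent (?Q (x\<^sub>0 \<otimes> inv z))) \<le> ent (?r z)" if z: "z \<in> Z" for z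
  proof (rule ent_ge_three_quarters[OF \<eta>])
    have zc: "z \<in> carrier G" "z \<notin> coset H c" using z set[OF R] by (auto simp: Z_def)
    have nP: "z \<otimes> y\<^sub>0 \<notin> coset H x\<^sub>0" and nQ: "x\<^sub>0 \<otimes> inv z \<notin> coset H y\<^sub>0" using H_flip zc by auto
    show "0 \<le> ?P (z \<otimes> y\<^sub>0)" "0 \<le> ?Q (x\<^sub>0 \<otimes> inv z)" by auto
    show "?P (z \<otimes> y\<^sub>0) \<le> \<eta>" using prob_two_cosets[OF X _ x0 nP] zc y0 pX by simp
    show "?Q (x\<^sub>0 \<otimes> inv z) \<le> \<eta>" using prob_two_cosets[OF Y _ y0 nQ] zc x0 pY by simp
    show "?r z \<le> 2 * \<eta>" using prob_two_cosets[OF R zc(1) cc zc(2)] rc by simp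
    have yin: "y\<^sub>0 \<in> coset H y\<^sub>0" using y0 one_H by (simp add: coset_def)
    have ne: "y\<^sub>0 \<noteq> x\<^sub>0 \<otimes> inv z" using nQ yin by auto
    have nQ': "y\<^sub>0 \<notin> coset H (x\<^sub>0 \<otimes> inv z)"
    proof
      assume a: "y\<^sub>0 \<in> coset H (x\<^sub>0 \<otimes> inv z)"
      show False using coset_meet[OF _ y0 a yin] nQ zc x0 by auto
    qed
    have "z \<otimes> (x\<^sub>0 \<otimes> inv z) = x\<^sub>0" using zc x0 by (simp add: m_lcomm)
    then have "?Q y\<^sub>0 * ?P (z \<otimes> y\<^sub>0) + ?Q (x\<^sub>0 \<otimes> inv z) * ?P x\<^sub>0 \<le> ?r z"
      using blur_diff_ge_sum_cosets[OF X Y zc(1), of "{y\<^sub>0, x\<^sub>0 \<otimes> inv z}"] y0 x0 zc ne nQ nQ' by auto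
    moreover have "(1 - \<eta>) * ?P (z \<otimes> y\<^sub>0) \<le> ?Q y\<^sub>0 * ?P (z \<otimes> y\<^sub>0)" using pY by (intro mult_right_mono) auto
    moreover have "?Q (x\<^sub>0 \<otimes> inv z) * (1 - \<eta>) \<le> ?Q (x\<^sub>0 \<otimes> inv z) * ?P x\<^sub>0" using pX by (intro mult_left_mono) auto
    ultimately show "(1 - \<eta>) * (?P (z \<otimes> y\<^sub>0) + ?Q (x\<^sub>0 \<otimes> inv z)) \<le> ?r z"
      by (simp add: algebra_simps)
  qed
  have Zf: "finite Z" "Z \<subseteq> carrier G" using set[OF R] by (auto simp: Z_def)
  have r_pos: "x \<otimes> inv y \<in> set_pmf (blur ?R)" if "x \<in> set_pmf (blur X)" "y \<in> set_pmf (blur Y)" for x y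
    unfolding blur_diff[OF X Y] unfolding diff_pmf_def using that by force
  have pos: "x\<^sub>0 \<in> set_pmf (blur X)" "y\<^sub>0 \<in> set_pmf (blur Y)"
    using pX pY e by (auto simp: set_pmf_iff)
  let ?tX = "\<Sum>x\<in>set_pmf (blur X) - coset H x\<^sub>0. ent (?P x)"
  let ?tY = "\<Sum>y\<in>set_pmf (blur Y) - coset H y\<^sub>0. ent (?Q y)"
  have tX: "?tX \<le> (\<Sum>z\<in>Z. ent (?P (z \<otimes> y\<^sub>0)))"
  proof -
    let ?A = "set_pmf (blur X) - coset H x\<^sub>0"
    have A: "?A \<subseteq> carrier G" using set[OF X] by auto
    have inj: "inj_on (\<lambda>x. x \<otimes> inv y\<^sub>0) ?A" using A y0 by (auto simp: inj_on_def subset_iff)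
    have cancel: "x \<otimes> inv y\<^sub>0 \<otimes> y\<^sub>0 = x" if "x \<in> carrier G" for x using that y0 by (simp add: m_assoc)
    have "?tX = (\<Sum>x\<in>?A. ent (?P (x \<otimes> inv y\<^sub>0 \<otimes> y\<^sub>0)))"
      using A cancel by (intro sum.cong) auto
    also have "\<dots> = (\<Sum>z\<in>(\<lambda>x. x \<otimes> inv y\<^sub>0) ` ?A. ent (?P (z \<otimes> y\<^sub>0)))"
      using sum.reindex[OF inj, of "\<lambda>z. ent (?P (z \<otimes> y\<^sub>0))"] by simp
    also have "\<dots> \<le> (\<Sum>z\<in>Z. ent (?P (z \<otimes> y\<^sub>0)))"
    proof (rule sum_mono2[OF Zf(1)])
      show "(\<lambda>x. x \<otimes> inv y\<^sub>0) ` ?A \<subseteq> Z"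
      proof
        fix z assume "z \<in> (\<lambda>x. x \<otimes> inv y\<^sub>0) ` ?A"
        then obtain x where x: "x \<in> ?A" "z = x \<otimes> inv y\<^sub>0" by auto
        then have "x \<in> carrier G" using A by auto
        then show "z \<in> Z" using x r_pos pos H_flip(1)[of z] y0 cancel by (auto simp: Z_def)
      qed
    qed (use Zf y0 X in \<open>auto intro!: ent_blur_nonneg\<close>)
    finally show ?thesis .
  qed
  have tY: "?tY \<le> (\<Sum>z\<in>Z. ent (?Q (x\<^sub>0 \<otimes> inv z)))"
  proof -
    let ?A = "set_pmf (blur Y) - coset H y\<^sub>0"
    have A: "?A \<subseteq> carrier G" using set[OF Y] by auto
    have cancel: "x\<^sub>0 \<otimes> inv (x\<^sub>0 \<otimes> inv y) = y" if "y \<in> carrier G" for y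
      using that x0 by (simp add: inv_mult_group m_lcomm[of x\<^sub>0 y "inv x\<^sub>0"])
    have inj: "inj_on (\<lambda>y. x\<^sub>0 \<otimes> inv y) ?A"
      by (rule inj_on_inverseI[where g = "\<lambda>z. x\<^sub>0 \<otimes> inv z"]) (use A cancel in auto)
    have "?tY = (\<Sum>y\<in>?A. ent (?Q (x\<^sub>0 \<otimes> inv (x\<^sub>0 \<otimes> inv y))))"
      using A cancel by (intro sum.cong) auto
    also have "\<dots> = (\<Sum>z\<in>(\<lambda>y. x\<^sub>0 \<otimes> inv y) ` ?A. ent (?Q (x\<^sub>0 \<otimes> inv z)))"
      using sum.reindex[OF inj, of "\<lambda>z. ent (?Q (x\<^sub>0 \<otimes> inv z))"] by simp
    also have "\<dots> \<le> (\<Sum>z\<in>Z. ent (?Q (x\<^sub>0 \<otimes> inv z)))"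
    proof (rule sum_mono2[OF Zf(1)])
      show "(\<lambda>y. x\<^sub>0 \<otimes> inv y) ` ?A \<subseteq> Z"
      proof
        fix z assume "z \<in> (\<lambda>y. x\<^sub>0 \<otimes> inv y) ` ?A"
        then obtain y where y: "y \<in> ?A" "z = x\<^sub>0 \<otimes> inv y" by auto
        then have "y \<in> carrier G" using A by auto
        then show "z \<in> Z" using y r_pos pos H_flip(2)[of z] x0 cancel by (auto simp: Z_def)
      qed
    qed (use Zf x0 Y in \<open>auto intro!: ent_blur_nonneg\<close>)
    finally show ?thesis .
  qed
  define \<alpha> where "\<alpha> = shannon_entropy (blur X) - ln (card H)"
  define \<beta> where "\<beta> = shannon_entropy (blur Y) - ln (card H)"
  define \<gamma> where "\<gamma> = shannon_entropy (blur ?R) - ln (card H)"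
  have ab: "?n * \<alpha> \<le> 43/40 * ?tX" "?n * \<beta> \<le> 43/40 * ?tY"
    unfolding \<alpha>_def \<beta>_def using X Y x0 y0 \<eta> pX pY entropy_blur_excess_le_tail by auto
  have "0 \<le> \<alpha>" "0 \<le> \<beta>" unfolding \<alpha>_def \<beta>_def using entropy_blur_ge X Y by auto
  then have ab0: "0 \<le> ?n * \<alpha>" "0 \<le> ?n * \<beta>" by auto
  have "3/4 * (?tX + ?tY) \<le> 3/4 * ((\<Sum>z\<in>Z. ent (?P (z \<otimes> y\<^sub>0))) + (\<Sum>z\<in>Z. ent (?Q (x\<^sub>0 \<otimes> inv z))))"
    using tX tY by (intro mult_left_mono add_mono) auto
  also have "\<dots> = (\<Sum>z\<in>Z. 3/4 * (ent (?P (z \<otimes> y\<^sub>0)) + ent (?Q (x\<^sub>0 \<otimes> inv z))))"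
    by (simp only: sum.distrib[symmetric] sum_distrib_left)
  also have "\<dots> \<le> (\<Sum>z\<in>Z. ent (?r z))" by (rule sum_mono[OF point])
  also have "\<dots> \<le> (\<Sum>z\<in>set_pmf (blur ?R). ent (?r z))"
    using set[OF R] R by (intro sum_mono2 ent_blur_nonneg) (auto simp: Z_def)
  also have "\<dots> = ?n * \<gamma>" unfolding \<gamma>_def by (rule entropy_blur_excess[OF R, symmetric])
  finally have g: "3/4 * (?tX + ?tY) \<le> ?n * \<gamma>" .
  have "?n * (3/5 * (\<alpha> + \<beta>)) = 3/5 * (?n * \<alpha> + ?n * \<beta>)" by (simp add: algebra_simps)
  \<comment> \<open>The factor \<open>3/4\<close> of the pointwise bound and the factor
    \<open>40/43\<close> from the tail bounds multiply to \<open>30/43\<close>, which is above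
    \<open>3/5\<close>.\<close>
  also have "\<dots> \<le> ?n * \<gamma>"
  proof -
    have "3/5 * (a + b) \<le> c"
      if "3/4 * (s + t) \<le> c" "a \<le> 43/40 * s" "b \<le> 43/40 * t" "0 \<le> a" "0 \<le> b" for a b c s t :: real
      using that by (simp add: field_simps)
    from this[OF g ab ab0] show ?thesis .
  qed
  finally have "3/5 * (\<alpha> + \<beta>) \<le> \<gamma>" using card_H by simp
  then show ?thesis unfolding \<alpha>_def \<beta>_def \<gamma>_def .
qed

end

section \<open>Choice of the constants and conclusion\<close>

lemma (in abelian_group_law) small_ruzsa_dist_subgroup:
  assumes X: "group_valued G X" and Y: "group_valued G Y" and small: "ruzsa_dist G X Y \<le> (1/2)^37"
  shows "\<exists>H. subgroup H G \<and> finite H \<and>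
    ruzsa_dist G X (pmf_of_set H) \<le> 12 * ruzsa_dist G X Y \<and>
    ruzsa_dist G Y (pmf_of_set H) \<le> 12 * ruzsa_dist G X Y"
proof -
  \<comment> \<open>The exponent \<open>37\<close> fits \<open>d = 1/256\<close>: the exceptional
    mass is \<open>2 * 2^(-37) / d^2 = 2^(-20)\<close>, which is \<open>\<eta>\<close>.\<close>
  define \<eta> :: real where "\<eta> = (1/2)^20"
  obtain H x\<^sub>0 y\<^sub>0 where H: "subgroup H G" "finite H" and x0: "x\<^sub>0 \<in> carrier G" and y0: "y\<^sub>0 \<in> carrier G"
    and cY: "\<forall>h\<in>H. close_pmf Y (shift h Y) (2 * (1/256))"
    and pX: "1 - \<eta> \<le> measure_pmf.prob X {x \<in> carrier G. x \<otimes> inv x\<^sub>0 \<in> H}"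
    and pY: "1 - \<eta> \<le> measure_pmf.prob Y {y \<in> carrier G. y \<otimes> inv y\<^sub>0 \<in> H}"
    using small_ruzsa_dist_almost_stabilizer[OF X Y small, of "1/256" \<eta>]
    by (auto simp: \<eta>_def power_one_over)
  interpret finite_subgroup_law G H
    by (intro finite_subgroup_law.intro finite_subgroup_law_axioms.intro abelian_group_law_axioms H)
  let ?R = "diff_pmf G X Y"
  have R: "group_valued G ?R" using X Y by (rule group_valued_diff)
  have fin: "finite (set_pmf (blur Z))" if "group_valued G Z" for Z
    using group_valued_blur[OF that] by (simp add: group_valued_def)
  have DX: "0 \<le> kl_div X (blur X)" and DY: "0 \<le> kl_div Y (blur Y)"
    using X Y fin set_pmf_blur by (auto intro!: kl_div_nonneg)
  have "close_pmf Y (blur Y) (2 * (1/256))" using Y cY by (intro close_pmf_blur) auto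
  then have "(\<Sum>y\<in>set_pmf (blur Y). \<bar>pmf Y y - pmf (blur Y) y\<bar>) \<le> 2 * (2 * (1/256))"
    using fin[OF Y] set_pmf_blur[OF Y] by (intro l1_le_of_close_pmf) auto
  then have "16 * (\<Sum>y\<in>set_pmf (blur Y). \<bar>pmf Y y - pmf (blur Y) y\<bar>) * kl_div X (blur X)
      \<le> 16 * (2 * (2 * (1/256))) * kl_div X (blur X)"
    using DX by (intro mult_right_mono mult_left_mono) auto
  \<comment> \<open>Here \<open>d = 1/256\<close> is used again:
    \<open>16 * (2 * (2 / 256)) = 1/4\<close>.\<close>
  then have k: "kl_div ?R (blur ?R) \<le> 1/4 * kl_div X (blur X)"
    using kl_div_diff_le[OF X Y] by simp
  have "3/5 * ((shannon_entropy (blur X) - ln (card H)) + (shannon_entropy (blur Y) - ln (card H)))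
    \<le> shannon_entropy (blur ?R) - ln (card H)"
    using pX pY prob_coset[OF X x0] prob_coset[OF Y y0]
    by (intro entropy_blur_diff_ge[OF X Y x0 y0 \<eta>_def]) (auto simp: coset_def)
  moreover have "ruzsa_dist G X Y = shannon_entropy (blur ?R) - kl_div ?R (blur ?R)
     - (shannon_entropy (blur X) - kl_div X (blur X)) / 2 - (shannon_entropy (blur Y) - kl_div Y (blur Y)) / 2"
    unfolding ruzsa_dist_def kl_div_blur[OF X] kl_div_blur[OF Y] kl_div_blur[OF R] by simp
  moreover have "ln (card H) \<le> shannon_entropy (blur X)" "ln (card H) \<le> shannon_entropy (blur Y)"
    using entropy_blur_ge X Y by auto
  \<comment> \<open>Together the bounds show that the distance of \<open>X\<close> and
    \<open>Y\<close> is at least \<open>(\<alpha>(X) + \<alpha>(Y))/10 + D(X)/4 + D(Y)/2\<close>,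
    while the distances to \<open>U\<^sub>H\<close> are \<open>(\<alpha>(X) + D(X))/2\<close> and
    \<open>(\<alpha>(Y) + D(Y))/2\<close>.\<close>
  ultimately have "ruzsa_dist G X (pmf_of_set H) \<le> 12 * ruzsa_dist G X Y"
     "ruzsa_dist G Y (pmf_of_set H) \<le> 12 * ruzsa_dist G X Y"
    unfolding ruzsa_dist_uniform[OF X] ruzsa_dist_uniform[OF Y] using DX DY k by argo+
  then show ?thesis using H by blast
qed

subsection \<open>Independence of the type\<close>

lemma admissible_const_pow: "admissible_const TYPE('a) ((1/2)^37)"
  unfolding admissible_const_def
proof (intro allI impI)
  fix G :: "'a monoid" and X Y
  assume "comm_group G" "group_valued G X" "group_valued G Y" "ruzsa_dist G X Y \<le> (1/2)^37"
  from \<open>comm_group G\<close> interpret abelian_group_law G by (simp add: abelian_group_law_def)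
  show "\<exists>H. subgroup H G \<and> finite H \<and>
    ruzsa_dist G X (pmf_of_set H) \<le> 12 * ruzsa_dist G X Y \<and>
    ruzsa_dist G Y (pmf_of_set H) \<le> 12 * ruzsa_dist G X Y"
    by (rule small_ruzsa_dist_subgroup) fact+
qed

text \<open>Starting from \<open>S\<close> with the unit added, the set of all differences is taken
  repeatedly. The stages are finite, and increasing because they contain the unit, so their union is
  countable and closed under differences.\<close>

lemma (in group) countable_subgroup_of_finite:
  assumes S: "finite S" "S \<subseteq> carrier G"
  shows "\<exists>K. subgroup K G \<and> countable K \<and> S \<subseteq> K"
proof -
  define A where "A n = ((\<lambda>B. (\<lambda>(x, y). x \<otimes> inv y) ` (B \<times> B)) ^^ n) (insert \<one> S)" for n
  define K where "K = (\<Union>n. A n)"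
  have A0: "A 0 = insert \<one> S" and AS: "A (Suc n) = (\<lambda>(x, y). x \<otimes> inv y) ` (A n \<times> A n)" for n
    by (auto simp: A_def)
  have A: "finite (A n) \<and> A n \<subseteq> carrier G \<and> \<one> \<in> A n" for n
  proof (induction n)
    case 0
    then show ?case using S by (simp add: A0)
  next
    case (Suc n)
    then have "(\<one>, \<one>) \<in> A n \<times> A n" by auto
    then have "\<one> \<otimes> inv \<one> \<in> A (Suc n)" unfolding AS by force
    then show ?case using Suc by (auto simp: AS)
  qed
  have mono: "A n \<subseteq> A (Suc n)" for n
  proof
    fix x assume x: "x \<in> A n"
    then have "x \<otimes> inv \<one> \<in> A (Suc n)" unfolding AS using A[of n] by force
    then show "x \<in> A (Suc n)" using x A[of n] by auto
  qed
  have diff: "x \<otimes> inv y \<in> K" if xy: "x \<in> K" "y \<in> K" for x y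
  proof -
    obtain m n where "x \<in> A m" "y \<in> A n" using xy by (auto simp: K_def)
    then have "x \<in> A (max m n)" "y \<in> A (max m n)"
      using lift_Suc_mono_le[of A, OF mono] by (meson max.cobounded1 max.cobounded2 subsetD)+
    then have "x \<otimes> inv y \<in> A (Suc (max m n))" unfolding AS by force
    then show ?thesis by (auto simp: K_def)
  qed
  have Kc: "K \<subseteq> carrier G" and K1: "\<one> \<in> K" using A by (auto simp: K_def)
  have inv: "inv y \<in> K" if y: "y \<in> K" for y
    using diff[OF K1 y] Kc y by auto
  have "subgroup K G"
  proof (rule subgroupI)
    show "x \<otimes> y \<in> K" if "x \<in> K" "y \<in> K" for x y
      using diff[OF that(1) inv[OF that(2)]] Kc that by auto
  qed (use Kc K1 inv in auto)
  moreover have "countable K"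
    unfolding K_def by (rule countable_UN) (use A in \<open>auto intro: countable_finite\<close>)
  moreover have "S \<subseteq> K" using A0 by (auto simp: K_def)
  ultimately show ?thesis by blast
qed

text \<open>The laws of \<open>X\<close>, \<open>Y\<close> and \<open>X - Y\<close> all live on
  \<open>K\<close>, where \<open>f\<close> is injective and respects differences; so none of the
  three entropies changes.\<close>

lemma ruzsa_dist_map:
  assumes inj: "inj_on f K" and X: "set_pmf X \<subseteq> K" and Y: "set_pmf Y \<subseteq> K"
    and cl: "\<And>x y. x \<in> K \<Longrightarrow> y \<in> K \<Longrightarrow> x \<otimes>\<^bsub>G\<^esub> inv\<^bsub>G\<^esub> y \<in> K"
    and hom: "\<And>x y. x \<in> K \<Longrightarrow> y \<in> K \<Longrightarrow> f (x \<otimes>\<^bsub>G\<^esub> inv\<^bsub>G\<^esub> y) = f x \<otimes>\<^bsub>G'\<^esub> inv\<^bsub>G'\<^esub> f y"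
  shows "ruzsa_dist G' (map_pmf f X) (map_pmf f Y) = ruzsa_dist G X Y"
proof -
  have "diff_pmf G' (map_pmf f X) (map_pmf f Y)
      = map_pmf (\<lambda>(x, y). f x \<otimes>\<^bsub>G'\<^esub> inv\<^bsub>G'\<^esub> f y) (pair_pmf X Y)"
    unfolding diff_pmf_def pair_map_pmf1 pair_map_pmf2 pmf.map_comp
    by (intro pmf.map_cong) (auto simp: o_def apfst_def apsnd_def)
  also have "\<dots> = map_pmf f (diff_pmf G X Y)"
    unfolding diff_pmf_def pmf.map_comp using X Y hom
    by (intro pmf.map_cong) (auto simp: subset_iff)
  finally have 1: "diff_pmf G' (map_pmf f X) (map_pmf f Y) = map_pmf f (diff_pmf G X Y)" .
  have "set_pmf (diff_pmf G X Y) \<subseteq> K" using X Y cl by (auto simp: diff_pmf_def)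
  then show ?thesis
    unfolding ruzsa_dist_def 1 using inj X Y by (simp add: shannon_entropy_map_inj inj_on_subset)
qed

text \<open>For arbitrary \<open>\<epsilon>\<close> this cannot be read off the explicit constant.
  The subgroup found in the copy is pulled back to \<open>G\<close>; the distances agree because its
  uniform law lives on \<open>K\<close>, too.\<close>

lemma admissible_const_transfer:
  assumes nat: "admissible_const TYPE(nat) \<epsilon>"
  shows "admissible_const TYPE('a) \<epsilon>"
  unfolding admissible_const_def
proof (intro allI impI)
  fix G :: "'a monoid" (structure) and X Y
  assume G: "comm_group G" and X: "group_valued G X" and Y: "group_valued G Y"
    and small: "ruzsa_dist G X Y \<le> \<epsilon>"
  interpret comm_group G by (rule G)
  obtain K where K: "subgroup K G" "countable K" "set_pmf X \<union> set_pmf Y \<subseteq> K"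
    using countable_subgroup_of_finite[of "set_pmf X \<union> set_pmf Y"] X Y by (auto simp: group_valued_def)
  have Kc: "K \<subseteq> carrier G" using K(1) by (rule subgroup.subset)
  \<comment> \<open>An enumeration that is injective on \<open>K\<close> whether \<open>K\<close> is
    finite or infinite; its image becomes the carrier of the copy.\<close>
  define f where "f = to_nat_on K"
  define g where "g = inv_into K f"
  have inj: "inj_on f K" unfolding f_def using K(2) by (rule inj_on_to_nat_on)
  have gf: "g (f x) = x" if "x \<in> K" for x using that inj by (simp add: g_def)
  have mK: "x \<in> K \<Longrightarrow> y \<in> K \<Longrightarrow> x \<otimes> y \<in> K" "x \<in> K \<Longrightarrow> inv x \<in> K" and oneK: "\<one> \<in> K" for x y
    using K(1) by (auto intro: subgroup.m_closed subgroup.m_inv_closed subgroup.one_closed)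
  define G' :: "nat monoid" where
    "G' = \<lparr>carrier = f ` K, mult = (\<lambda>a b. f (g a \<otimes> g b)), one = f \<one>\<rparr>"
  have mult': "f x \<otimes>\<^bsub>G'\<^esub> f y = f (x \<otimes> y)" if "x \<in> K" "y \<in> K" for x y
    using that by (simp add: G'_def gf)
  have carrier': "carrier G' = f ` K" and one': "\<one>\<^bsub>G'\<^esub> = f \<one>" by (simp_all add: G'_def)
  have G': "comm_group G'"
  proof (rule comm_groupI)
    fix a assume "a \<in> carrier G'"
    then obtain x where x: "x \<in> K" "a = f x" by (auto simp: carrier')
    then show "\<exists>b\<in>carrier G'. b \<otimes>\<^bsub>G'\<^esub> a = \<one>\<^bsub>G'\<^esub>"
      using Kc mK by (intro bexI[of _ "f (inv x)"]) (auto simp: carrier' one' mult' subset_iff)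
  qed (use Kc mK oneK in \<open>auto simp: carrier' one' mult' subset_iff m_ac\<close>)
  interpret N: comm_group G' by (rule G')
  have inv': "inv\<^bsub>G'\<^esub> f x = f (inv x)" if x: "x \<in> K" for x
    using x Kc mK oneK by (intro N.inv_equality) (auto simp: carrier' one' mult' subset_iff)
  have dist: "ruzsa_dist G' (map_pmf f P) (map_pmf f Q) = ruzsa_dist G P Q"
    if "set_pmf P \<subseteq> K" "set_pmf Q \<subseteq> K" for P Q
    using inj that mK by (intro ruzsa_dist_map[where K = K]) (auto simp: inv' mult')
  have "group_valued G' (map_pmf f X)" "group_valued G' (map_pmf f Y)"
    using X Y K(3) by (auto simp: group_valued_def carrier')
  moreover have "ruzsa_dist G' (map_pmf f X) (map_pmf f Y) \<le> \<epsilon>" using small dist K(3) by simp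
  ultimately obtain H' where H': "subgroup H' G'" "finite H'"
    "ruzsa_dist G' (map_pmf f X) (pmf_of_set H') \<le> 12 * ruzsa_dist G' (map_pmf f X) (map_pmf f Y)"
    "ruzsa_dist G' (map_pmf f Y) (pmf_of_set H') \<le> 12 * ruzsa_dist G' (map_pmf f X) (map_pmf f Y)"
    using nat G' unfolding admissible_const_def by blast
  define H where "H = g ` H'"
  have H'K: "H' \<subseteq> f ` K" using subgroup.subset[OF H'(1)] by (simp add: carrier')
  have HK: "H \<subseteq> K" unfolding H_def g_def using H'K by (auto intro: inv_into_into)
  have H'eq: "H' = f ` H" unfolding H_def g_def image_image using H'K by (force simp: f_inv_into_f)
  have memH: "x \<in> H \<longleftrightarrow> f x \<in> H'" if "x \<in> K" for x
    using that HK inj unfolding H'eq by (simp add: inj_on_image_mem_iff)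
  have ne: "H \<noteq> {}" using memH[OF oneK] subgroup.one_closed[OF H'(1)] one' by auto
  have fin: "finite H" unfolding H_def using H'(2) by simp
  have "subgroup H G"
  proof (rule subgroupI)
    show "H \<subseteq> carrier G" using HK Kc by auto
    show "H \<noteq> {}" by (rule ne)
    show "inv x \<in> H" if x: "x \<in> H" for x
    proof -
      have "x \<in> K" using x HK by auto
      then show ?thesis using subgroup.m_inv_closed[OF H'(1), of "f x"] x memH inv' mK by simp
    qed
    show "x \<otimes> y \<in> H" if xy: "x \<in> H" "y \<in> H" for x y
    proof -
      have "x \<in> K" "y \<in> K" using xy HK by auto
      then show ?thesis using subgroup.m_closed[OF H'(1), of "f x" "f y"] xy memH mult' mK by simp
    qed
  qed
  moreover have "pmf_of_set H' = map_pmf f (pmf_of_set H)"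
    unfolding H'eq using inj HK ne fin by (intro map_pmf_of_set_inj[symmetric]) (auto intro: inj_on_subset)
  ultimately show "\<exists>H. subgroup H G \<and> finite H \<and>
    ruzsa_dist G X (pmf_of_set H) \<le> 12 * ruzsa_dist G X Y \<and>
    ruzsa_dist G Y (pmf_of_set H) \<le> 12 * ruzsa_dist G X Y"
    using H' dist K(3) HK fin ne by (intro exI[of _ H]) auto
qed

theorem proposition1p3:
  "(\<exists>\<epsilon>\<^sub>0>0. admissible_const TYPE(nat) \<epsilon>\<^sub>0) \<and>
   (\<forall>\<epsilon>\<^sub>0>0. admissible_const TYPE(nat) \<epsilon>\<^sub>0 \<longrightarrow> admissible_const TYPE('a) \<epsilon>\<^sub>0)"
proof (intro conjI allI impI)
  show "\<exists>\<epsilon>\<^sub>0>0. admissible_const TYPE(nat) \<epsilon>\<^sub>0"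
    by (rule exI[of _ "(1/2)^37"]) (simp add: admissible_const_pow)
qed (rule admissible_const_transfer)

end
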